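(* Assume $\mathfrak s=\mathfrak b$. Then for every $n\geq 1$ there exists an almost disjoint family $\mathcal A$ of infinite subsets of $\omega^{n+1}$, of size $\mathfrak c$, such that its Franklin space $\mathcal F(\mathcal A)$ is $n$-sequentially compact but not $(n+1)$-sequentially compact.
   Context: $[B]^n$ denotes the set of all subsets of $B$ of cardinality $n$ and $[B]^\omega$ the set of all countably infinite subsets of $B$. For a topological space $X$, a countable set $B$, $n\ge 1$, a function $f:[B]^n\to X$ and $p\in X$, $f$ converges to $p$ if for every neighborhood $U$ of $p$ there is a finite $F\subseteq B$ with $f''[B\setminus F]^n\subseteq U$ (where $f''S=\{f(x):x\in S\}$); $f$ is convergent if it converges to some $p\in X$. The space $X$ is $n$-sequentially compact if for every $f:[\omega]^n\to X$ there is $B\in[\omega]^\omega$ such that $f\restriction[B]^n$ is convergent. An almost disjoint family on a countable set $N$ is a family of infinite subsets of $N$ any two distinct members of which have finite intersection. For such $\mathcal A$, the Isbell–Mrówka space $\Psi(\mathcal A)$ is $N\cup\mathcal A$, where points of $N$ are isolated and basic neighborhoods of $A\in\mathcal A$ are $\{A\}\cup(A\setminus F)$ with $F\subseteq N$ finite. The Franklin space $\mathcal F(\mathcal A)=\Psi(\mathcal A)\cup\{\infty\}$ is the one-point compactification of $\Psi(\mathcal A)$; basic neighborhoods of $\infty$ are $\{\infty\}\cup(\mathcal A\setminus\{A_0,\dots,A_k\})\cup\big(N\setminus(F\cup\bigcup_{m\le k}A_m)\big)$ with $A_0,\dots,A_k\in\mathcal A$ and $F\subseteq N$ finite. For $f,g\in\omega^\omega$,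 $f\le^* g$ means that $\{k:f(k)>g(k)\}$ is finite. $\mathfrak b$ is the minimum size of a family $\mathcal B\subseteq\omega^\omega$ such that for every $f\in\omega^\omega$ there is $b\in\mathcal B$ with $b\not\le^* f$. $\mathfrak s$ is the minimum size of a splitting family, i.e. a family $\mathcal S\subseteq[\omega]^\omega$ such that for every $X\in[\omega]^\omega$ there is $S\in\mathcal S$ with both $X\cap S$ and $X\setminus S$ infinite. $\mathfrak c=|\mathbb R|$. *)

theory Defs
  imports "HOL-Analysis.Analysis" "HOL-Library.Ramsey"
begin

unbundle cardinal_syntax

section \<open>Cardinal characteristics\<close>

text \<open>The least cardinality of a set satisfying \<open>P\<close>, as a cardinal order. It is attained as soon
  as some set satisfies \<open>P\<close>, and is unique up to \<open>=o\<close>, which is the equality of cardinals.\<close>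

definition min_card :: "('a set \<Rightarrow> bool) \<Rightarrow> 'a rel" where
  "min_card P = (SOME r. \<exists>A. P A \<and> r = |A| \<and> (\<forall>B. P B \<longrightarrow> |A| \<le>o |B| ))"

lemma min_card_attained:
  assumes "P B"
  obtains A where "P A" "min_card P = |A|" "\<And>C. P C \<Longrightarrow> |A| \<le>o |C|"
proof -
  have "\<exists>r\<in>card_of ` Collect P. \<forall>r'\<in>card_of ` Collect P. r \<le>o r'"
    using assms by (intro exists_minim_Card_order) (auto simp: card_of_Card_order)
  then have "\<exists>r A. P A \<and> r = |A| \<and> (\<forall>B. P B \<longrightarrow> |A| \<le>o |B| )"
    by auto
  from someI_ex[OF this] that show thesis
    unfolding min_card_def by blast
qed

definition eventually_le :: "(nat \<Rightarrow> nat) \<Rightarrow> (nat \<Rightarrow> nat) \<Rightarrow> bool" (infix \<open>\<le>\<^sup>*\<close> 50) where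
  "f \<le>\<^sup>* g \<longleftrightarrow> finite {k. f k > g k}"

definition unbounded_family :: "(nat \<Rightarrow> nat) set \<Rightarrow> bool" where
  "unbounded_family \<B> \<longleftrightarrow> (\<forall>f. \<exists>b\<in>\<B>. \<not> b \<le>\<^sup>* f)"

definition splitting_family :: "nat set set \<Rightarrow> bool" where
  "splitting_family \<S> \<longleftrightarrow>
     (\<forall>S\<in>\<S>. infinite S) \<and>
     (\<forall>X. infinite X \<longrightarrow> (\<exists>S\<in>\<S>. infinite (X \<inter> S) \<and> infinite (X - S)))"

definition bounding_number :: "(nat \<Rightarrow> nat) rel" where
  "bounding_number = min_card unbounded_family"

definition splitting_number :: "nat set rel" where
  "splitting_number = min_card splitting_family"

lemma unbounded_family_UNIV: "unbounded_family UNIV"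
  unfolding unbounded_family_def
proof
  fix f
  have "\<not> (\<lambda>k. Suc (f k)) \<le>\<^sup>* f"
    by (simp add: eventually_le_def)
  then show "\<exists>b\<in>UNIV. \<not> b \<le>\<^sup>* f" by blast
qed

lemma splitting_family_infinite_sets: "splitting_family {S. infinite S}"
  unfolding splitting_family_def
proof (intro conjI allI impI)
  fix X :: "nat set"
  assume X: "infinite X"
  let ?S = "enumerate X ` {k. even k}"
  have inj: "inj (enumerate X)"
    using X by (simp add: inj_enumerate)
  have "range (\<lambda>k::nat. 2 * k) \<subseteq> {k. even k}" "range (\<lambda>k::nat. Suc (2 * k)) \<subseteq> {k. odd k}"
    by auto
  moreover have "infinite (range (\<lambda>k::nat. 2 * k))" "infinite (range (\<lambda>k::nat. Suc (2 * k)))"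
    by (simp_all add: range_inj_infinite inj_def)
  ultimately have "infinite {k::nat. even k}" "infinite {k::nat. odd k}"
    by (meson infinite_super)+
  then have *: "infinite ?S" "infinite (enumerate X ` {k. odd k})"
    by (simp_all add: finite_image_iff inj_on_subset[OF inj])
  have "?S \<subseteq> X" "enumerate X ` {k. odd k} \<subseteq> X - ?S"
    by (auto simp: enumerate_in_set[OF X] inj_eq[OF inj])
  with * have "infinite (X \<inter> ?S)" "infinite (X - ?S)"
    by (simp_all add: Int_absorb1 infinite_super)
  with * show "\<exists>S\<in>{S. infinite S}. infinite (X \<inter> S) \<and> infinite (X - S)" by blast
qed simp


section \<open>Higher-dimensional sequential compactness\<close>

text \<open>\<open>[B]\<^bsup>n\<^esup>\<close> is the library's \<^const>\<open>nsets\<close>. Only the values of \<open>f\<close> on \<open>[B]\<^bsup>n\<^esup>\<close> matter, so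
  \<open>nset_converges X n f B p\<close> says that the restriction of \<open>f\<close> to \<open>[B]\<^bsup>n\<^esup>\<close> converges to \<open>p\<close>.\<close>

definition nset_converges ::
  "'a topology \<Rightarrow> nat \<Rightarrow> ('b set \<Rightarrow> 'a) \<Rightarrow> 'b set \<Rightarrow> 'a \<Rightarrow> bool" where
  "nset_converges X n f B p \<longleftrightarrow>
     p \<in> topspace X \<and>
     (\<forall>U. openin X U \<and> p \<in> U \<longrightarrow> (\<exists>F. finite F \<and> F \<subseteq> B \<and> f ` [B - F]\<^bsup>n\<^esup> \<subseteq> U))"

definition n_sequentially_compact :: "nat \<Rightarrow> 'a topology \<Rightarrow> bool" where
  "n_sequentially_compact n X \<longleftrightarrow>
     (\<forall>f \<in> [UNIV :: nat set]\<^bsup>n\<^esup> \<rightarrow> topspace X.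
        \<exists>B :: nat set. infinite B \<and> (\<exists>p. nset_converges X n f B p))"


section \<open>Almost disjoint families, Isbell--Mrowka and Franklin spaces\<close>

definition almost_disjoint_family :: "'a set \<Rightarrow> 'a set set \<Rightarrow> bool" where
  "almost_disjoint_family N \<A> \<longleftrightarrow>
     (\<forall>A\<in>\<A>. A \<subseteq> N \<and> infinite A) \<and> pairwise (\<lambda>A B. finite (A \<inter> B)) \<A>"

text \<open>The point set is the disjoint union of \<open>N\<close> (tagged \<^const>\<open>Inl\<close>) and \<open>\<A>\<close> (tagged
  \<^const>\<open>Inr\<close>). A set is open iff with each \<open>A \<in> \<A>\<close> it contains a basic neighbourhood of \<open>A\<close>.\<close>

definition isbell_mrowka_space :: "'a set \<Rightarrow> 'a set set \<Rightarrow> ('a + 'a set) topology" where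
  "isbell_mrowka_space N \<A> = topology (\<lambda>U. U \<subseteq> N <+> \<A> \<and>
     (\<forall>A\<in>\<A>. Inr A \<in> U \<longrightarrow> (\<exists>F. finite F \<and> F \<subseteq> N \<and> Inl ` (A - F) \<subseteq> U)))"

definition franklin_space :: "'a set \<Rightarrow> 'a set set \<Rightarrow> ('a + 'a set) option topology" where
  "franklin_space N \<A> = Alexandroff_compactification (isbell_mrowka_space N \<A>)"

lemma openin_isbell_mrowka_space:
  "openin (isbell_mrowka_space N \<A>) U \<longleftrightarrow> U \<subseteq> N <+> \<A> \<and>
     (\<forall>A\<in>\<A>. Inr A \<in> U \<longrightarrow> (\<exists>F. finite F \<and> F \<subseteq> N \<and> Inl ` (A - F) \<subseteq> U))"
proof -
  let ?op = "\<lambda>U. U \<subseteq> N <+> \<A> \<and>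
     (\<forall>A\<in>\<A>. Inr A \<in> U \<longrightarrow> (\<exists>F. finite F \<and> F \<subseteq> N \<and> Inl ` (A - F) \<subseteq> U))"
  have "istopology ?op"
    unfolding istopology_def
  proof (rule conjI; intro allI impI)
    fix S T assume S: "?op S" and T: "?op T"
    have "\<exists>F. finite F \<and> F \<subseteq> N \<and> Inl ` (A - F) \<subseteq> S \<inter> T" if A: "A \<in> \<A>" "Inr A \<in> S \<inter> T" for A
    proof -
      obtain F G where "finite F" "F \<subseteq> N" "Inl ` (A - F) \<subseteq> S" "finite G" "G \<subseteq> N" "Inl ` (A - G) \<subseteq> T"
        using S T A by (metis (no_types, lifting) IntD1 IntD2)
      then show ?thesis by (intro exI[of _ "F \<union> G"]) auto
    qed
    moreover have "S \<inter> T \<subseteq> N <+> \<A>" using S by (meson Int_lower1 order_trans)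
    ultimately show "?op (S \<inter> T)" by simp
  next
    fix \<K> assume "\<forall>K\<in>\<K>. ?op K"
    then have 1: "K \<subseteq> N <+> \<A>" and
      2: "\<And>A. A \<in> \<A> \<Longrightarrow> Inr A \<in> K \<Longrightarrow> \<exists>F. finite F \<and> F \<subseteq> N \<and> Inl ` (A - F) \<subseteq> K"
      if "K \<in> \<K>" for K
      using that by simp_all
    show "?op (\<Union>\<K>)"
    proof (intro conjI ballI impI)
      show "\<Union>\<K> \<subseteq> N <+> \<A>" using 1 by (rule Union_least)
      fix A assume A: "A \<in> \<A>" "Inr A \<in> \<Union>\<K>"
      then obtain K where K: "K \<in> \<K>" "Inr A \<in> K" by (elim UnionE)
      from 2[OF K(1) A(1) K(2)] K(1) show "\<exists>F. finite F \<and> F \<subseteq> N \<and> Inl ` (A - F) \<subseteq> \<Union>\<K>"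
        by (meson Union_upper order_trans)
    qed
  qed
  then show ?thesis
    by (simp add: isbell_mrowka_space_def)
qed

lemma topspace_isbell_mrowka_space:
  assumes "almost_disjoint_family N \<A>"
  shows "topspace (isbell_mrowka_space N \<A>) = N <+> \<A>"
proof
  have "openin (isbell_mrowka_space N \<A>) (N <+> \<A>)"
    using assms unfolding openin_isbell_mrowka_space almost_disjoint_family_def by blast
  then show "N <+> \<A> \<subseteq> topspace (isbell_mrowka_space N \<A>)" by (rule openin_subset)
  show "topspace (isbell_mrowka_space N \<A>) \<subseteq> N <+> \<A>"
    using openin_topspace[of "isbell_mrowka_space N \<A>", unfolded openin_isbell_mrowka_space]
    by (rule conjunct1)
qed

definition franklin_nbhd :: "'a set \<Rightarrow> 'a set set \<Rightarrow> 'a set set \<Rightarrow> 'a set \<Rightarrow> ('a + 'a set) option set" where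
  "franklin_nbhd N \<A> \<A>\<^sub>0 F = insert None (Some ` ((N - (F \<union> \<Union>\<A>\<^sub>0)) <+> (\<A> - \<A>\<^sub>0)))"

text \<open>The Alexandroff compactification has the usual basic neighbourhoods at infinity.\<close>

lemma openin_franklin_nbhd:
  assumes ad: "almost_disjoint_family N \<A>" and \<A>0: "finite \<A>\<^sub>0" "\<A>\<^sub>0 \<subseteq> \<A>" and F: "finite F" "F \<subseteq> N"
  shows "openin (franklin_space N \<A>) (franklin_nbhd N \<A> \<A>\<^sub>0 F)"
proof -
  let ?X = "isbell_mrowka_space N \<A>"
  let ?K = "(F \<union> \<Union>\<A>\<^sub>0) <+> \<A>\<^sub>0"
  note top = topspace_isbell_mrowka_space[OF ad]
  have K: "?K \<subseteq> N <+> \<A>"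
    using \<A>0 F ad unfolding almost_disjoint_family_def by blast
  have A: "compactin ?X (insert (Inr A) (Inl ` A))" if "A \<in> \<A>" for A
    unfolding compactin_def
  proof (intro conjI allI impI)
    show "insert (Inr A) (Inl ` A) \<subseteq> topspace ?X"
      using that ad unfolding top almost_disjoint_family_def by blast
    fix \<U> assume \<U>: "(\<forall>U\<in>\<U>. openin ?X U) \<and> insert (Inr A) (Inl ` A) \<subseteq> \<Union>\<U>"
    then obtain U where U: "U \<in> \<U>" "Inr A \<in> U" "openin ?X U" by blast
    then obtain G where G: "finite G" "Inl ` (A - G) \<subseteq> U"
      using that unfolding openin_isbell_mrowka_space by blast
    have "\<forall>x\<in>A \<inter> G. \<exists>V\<in>\<U>. Inl x \<in> V" using \<U> by blast
    then obtain V where V: "\<And>x. x \<in> A \<inter> G \<Longrightarrow> V x \<in> \<U> \<and> Inl x \<in> V x" by metis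
    have "finite (insert U (V ` (A \<inter> G)))" using G(1) by simp
    moreover have "insert U (V ` (A \<inter> G)) \<subseteq> \<U>" using U(1) V by auto
    moreover have "insert (Inr A) (Inl ` A) \<subseteq> \<Union>(insert U (V ` (A \<inter> G)))"
      using G(2) U(2) V by fastforce
    ultimately show "\<exists>\<F>. finite \<F> \<and> \<F> \<subseteq> \<U> \<and> insert (Inr A) (Inl ` A) \<subseteq> \<Union>\<F>" by blast
  qed
  have "compactin ?X (\<Union>A\<in>\<A>\<^sub>0. insert (Inr A) (Inl ` A))"
    using \<A>0 A by (intro compactin_Union) auto
  moreover have "compactin ?X (Inl ` F)"
    using F by (intro finite_imp_compactin) (auto simp: top)
  moreover have "?K = Inl ` F \<union> (\<Union>A\<in>\<A>\<^sub>0. insert (Inr A) (Inl ` A))" by auto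
  ultimately have "compactin ?X ?K" by (simp add: compactin_Un)
  moreover have "closedin ?X ?K"
    unfolding closedin_def top openin_isbell_mrowka_space
  proof (intro conjI K ballI impI)
    show "(N <+> \<A>) - ?K \<subseteq> N <+> \<A>" by blast
    fix A assume A: "A \<in> \<A>" "Inr A \<in> (N <+> \<A>) - ?K"
    have "finite (A \<inter> B)" if B: "B \<in> \<A>\<^sub>0" for B
    proof -
      have "A \<noteq> B" "B \<in> \<A>" using A(2) B \<A>0(2) by auto
      then show ?thesis
        using ad A(1) unfolding almost_disjoint_family_def by (meson pairwiseD)
    qed
    then have "finite (F \<union> (\<Union>B\<in>\<A>\<^sub>0. A \<inter> B))" using F(1) \<A>0(1) by (intro finite_UnI finite_UN_I)
    moreover have "A \<subseteq> N" using A(1) ad unfolding almost_disjoint_family_def by simp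
    then have "F \<union> (\<Union>B\<in>\<A>\<^sub>0. A \<inter> B) \<subseteq> N" "Inl ` (A - (F \<union> (\<Union>B\<in>\<A>\<^sub>0. A \<inter> B))) \<subseteq> (N <+> \<A>) - ?K"
      using F(2) by auto
    ultimately show "\<exists>G. finite G \<and> G \<subseteq> N \<and> Inl ` (A - G) \<subseteq> (N <+> \<A>) - ?K" by blast
  qed
  moreover have "franklin_nbhd N \<A> \<A>\<^sub>0 F = insert None (Some ` (topspace ?X - ?K))"
    unfolding franklin_nbhd_def top
    by (rule arg_cong[where f = "\<lambda>S. insert None (Some ` S)"]) blast
  ultimately show ?thesis
    unfolding franklin_space_def openin_Alexandroff_compactification by blast
qed

lemma franklin_nbhd_base:
  assumes ad: "almost_disjoint_family N \<A>" and U: "openin (franklin_space N \<A>) U" "None \<in> U"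
  obtains \<A>\<^sub>0 F where "finite \<A>\<^sub>0" "\<A>\<^sub>0 \<subseteq> \<A>" "finite F" "F \<subseteq> N" "franklin_nbhd N \<A> \<A>\<^sub>0 F \<subseteq> U"
proof -
  let ?X = "isbell_mrowka_space N \<A>"
  note top = topspace_isbell_mrowka_space[OF ad]
  obtain C where C: "compactin ?X C" "U = insert None (Some ` (topspace ?X - C))"
    using U unfolding franklin_space_def openin_Alexandroff_compactification by blast
  define nb :: "'a + 'a set \<Rightarrow> ('a + 'a set) set"
    where "nb = case_sum (\<lambda>x. {Inl x}) (\<lambda>A. insert (Inr A) (Inl ` A))"
  have "openin ?X (nb p)" if "p \<in> N <+> \<A>" for p
    using that ad unfolding openin_isbell_mrowka_space nb_def almost_disjoint_family_def
    by (auto split: sum.splits)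
  moreover have "C \<subseteq> N <+> \<A>" "C \<subseteq> \<Union>(nb ` C)"
    using compactin_subset_topspace[OF C(1)] unfolding top nb_def by (force split: sum.splits)+
  ultimately have "\<exists>\<F>. finite \<F> \<and> \<F> \<subseteq> nb ` C \<and> C \<subseteq> \<Union>\<F>"
    using C(1) unfolding compactin_def by (elim conjE allE[of _ "nb ` C"]) blast
  then obtain \<F> where \<F>: "finite \<F>" "\<F> \<subseteq> nb ` C" "C \<subseteq> \<Union>\<F>" by blast
  then obtain P where P: "finite P" "P \<subseteq> C" "C \<subseteq> \<Union>(nb ` P)"
    using finite_subset_image[OF \<F>(1,2)] by blast
  have PN: "P \<subseteq> N <+> \<A>" using P(2) \<open>C \<subseteq> N <+> \<A>\<close> by blast
  show thesis
  proof (rule that)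
    show "finite (Inr -` P)" "finite (Inl -` P)"
      using P(1) by (simp_all add: finite_vimageI)
    show "Inr -` P \<subseteq> \<A>" "Inl -` P \<subseteq> N" using PN by auto
    have "p \<notin> C" if p: "p \<in> (N - (Inl -` P \<union> \<Union>(Inr -` P))) <+> (\<A> - Inr -` P)" for p
    proof
      assume "p \<in> C"
      then obtain q where "q \<in> P" "p \<in> nb q" using P(3) by blast
      with p show False unfolding nb_def by (cases q) auto
    qed
    then show "franklin_nbhd N \<A> (Inr -` P) (Inl -` P) \<subseteq> U"
      unfolding C(2) top franklin_nbhd_def by blast
  qed
qed

end

theory Submission
  imports Defs
begin

text \<open>
  Let \<open>\<kappa> = \<s> = \<b>\<close>, fix monotone \<open>g\<^sub>\<xi>\<close> (\<open>\<xi> < \<kappa>\<close>) forming an unbounded family and a splitting family \<open>S\<^sub>\<xi>\<close>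
  (\<open>\<xi> < \<kappa>\<close>). The node of an infinite \<open>E \<subseteq> \<omega>\<close> is the least \<open>\<xi>\<close> such that \<open>S\<^sub>\<xi>\<close> splits \<open>E\<close>, together with the
  sides of the earlier \<open>S\<^sub>\<zeta>\<close> that almost contain \<open>E\<close>. As in Shelah's construction of completely separable
  families, every infinite \<open>B\<close> has continuum many nodes of subsets, so one can choose \<open>E\<^sub>B \<subseteq> B\<close> with pairwise
  distinct nodes. The member of \<open>\<A>\<close> attached to \<open>B\<close> consists of increasing tuples from \<open>E\<^sub>B\<close>, with pairwise distinct
  first coordinates, whose first coordinate is in \<open>S\<^sub>\<xi>\<close> and whose second is not (\<open>\<xi>\<close> being the index of
  \<open>E\<^sub>B\<close>), and which grow faster than all \<open>g\<^sub>\<zeta>\<close>, \<open>\<zeta> < \<xi>\<close>. Then \<open>\<A>\<close> is almost disjoint, and mapping an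
  \<open>(n + 1)\<close>-set to the tuple of its elements has no convergent restriction.

  Given \<open>l : [\<omega>]\<^sup>n \<rightarrow> \<omega>\<^sup>n\<^sup>+\<^sup>1\<close> leaving every finite set, one thins out the domain until each of the \<open>n + 1\<close> coordinates of
  \<open>l x\<close> has the order of magnitude of one of the \<open>n\<close> elements of \<open>x\<close> (or is bounded). Two coordinates are then
  comparable, so on a smaller domain one is dominated by \<open>g\<^sub>\<alpha>\<close> of the other for some \<open>\<alpha>\<close>, and \<open>l\<close> eventually avoids
  all members of \<open>\<A>\<close> of index above \<open>\<alpha>\<close>. After homogenizing \<open>l\<close> for \<open>S\<^sub>\<zeta>\<close>, \<open>\<zeta> \<le> \<alpha>\<close>, only fewer than \<open>\<kappa>\<close> members remain
  relevant, and \<open>l\<close> can be homogenized for these as well.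
\<close>

section \<open>Convergence along a filter of finite sets\<close>


text \<open>Convergence of a restriction becomes a limit along this filter, so that finitely many
  \<open>eventually\<close> facts can be combined and passing to a subset of \<open>B\<close>
  refines the filter. Finite sets \<open>F\<close> not contained in \<open>B\<close> are allowed;
  this gives the same filter.\<close>

definition cofin_nsets :: "nat \<Rightarrow> 'a set \<Rightarrow> 'a set filter" where
  "cofin_nsets n B = (INF F\<in>{F. finite F}. principal ([B - F]\<^bsup>n\<^esup>))"

lemma eventually_cofin_nsets:
  "eventually P (cofin_nsets n B) \<longleftrightarrow> (\<exists>F. finite F \<and> (\<forall>x\<in>[B - F]\<^bsup>n\<^esup>. P x))"
  unfolding cofin_nsets_def
proof (subst eventually_INF_base)
  fix F G :: "'a set"
  assume "F \<in> {F. finite F}" "G \<in> {F. finite F}"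
  then show "\<exists>H\<in>{F. finite F}. principal ([B - H]\<^bsup>n\<^esup>) \<le> inf (principal ([B - F]\<^bsup>n\<^esup>)) (principal ([B - G]\<^bsup>n\<^esup>))"
    by (intro bexI[of _ "F \<union> G"]) (auto simp: nsets_def)
qed (auto simp: eventually_principal)

lemma nset_converges_iff_limitin:
  "nset_converges X n f B p \<longleftrightarrow> limitin X f p (cofin_nsets n B)"
proof -
  have "(\<exists>F. finite F \<and> F \<subseteq> B \<and> f ` [B - F]\<^bsup>n\<^esup> \<subseteq> U) \<longleftrightarrow>
      eventually (\<lambda>x. f x \<in> U) (cofin_nsets n B)" for U
    unfolding eventually_cofin_nsets
  proof (intro iffI; elim exE conjE)
    fix F assume "finite F" "\<forall>x\<in>[B - F]\<^bsup>n\<^esup>. f x \<in> U"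
    then show "\<exists>F. finite F \<and> F \<subseteq> B \<and> f ` [B - F]\<^bsup>n\<^esup> \<subseteq> U"
      by (intro exI[of _ "F \<inter> B"]) (auto simp: Diff_Int)
  qed blast
  then show ?thesis by (simp add: nset_converges_def limitin_def)
qed

lemma cofin_nsets_mono: "B \<subseteq> C \<Longrightarrow> cofin_nsets n B \<le> cofin_nsets n C"
  unfolding le_filter_def eventually_cofin_nsets
  by (meson Diff_mono nsets_mono order_refl subsetD)

lemma eventually_cofin_nsets_in: "\<forall>\<^sub>F x in cofin_nsets n B. x \<in> [B]\<^bsup>n\<^esup>"
  unfolding eventually_cofin_nsets by (rule exI[of _ "{}"]) simp

section \<open>Sets smaller than the bounding number\<close>

definition small :: "'a set \<Rightarrow> bool" where
  "small J \<longleftrightarrow> |J| <o bounding_number"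

lemma bounding_number_attained:
  obtains \<B> where "unbounded_family \<B>" "bounding_number = |\<B>|"
    "\<And>\<C>. unbounded_family \<C> \<Longrightarrow> |\<B>| \<le>o |\<C>|"
proof (rule min_card_attained[where P = unbounded_family, OF unbounded_family_UNIV])
  fix \<B> assume "unbounded_family \<B>" "min_card unbounded_family = |\<B>|"
    "\<And>\<C>. unbounded_family \<C> \<Longrightarrow> |\<B>| \<le>o |\<C>|"
  then show thesis by (intro that[of \<B>]) (simp_all add: bounding_number_def)
qed

lemma small_image:
  assumes "small J"
  shows "small (f ` J)"
  using ordLeq_ordLess_trans[OF card_of_image] assms unfolding small_def .

lemma small_inj:
  assumes "small J" "inj_on f I" "f ` I \<subseteq> J"
  shows "small I"
proof -
  have "|I| \<le>o |J|" using assms(2,3) by (intro card_of_ordLeq[THEN iffD1] exI conjI)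
  then show ?thesis using assms(1) unfolding small_def by (rule ordLeq_ordLess_trans)
qed

lemma small_subset: "small J \<Longrightarrow> I \<subseteq> J \<Longrightarrow> small I"
  using small_inj[of J id I] by simp

text \<open>By minimality of the bounding number, the image of \<open>J\<close> under
  \<open>h\<close> has too few elements to be unbounded.\<close>

lemma small_bounded:
  assumes "small J"
  shows "\<exists>G. \<forall>j\<in>J. h j \<le>\<^sup>* G"
proof (rule ccontr)
  assume "\<not> ?thesis"
  then have "unbounded_family (h ` J)" unfolding unbounded_family_def by auto
  moreover obtain \<B> where \<B>: "bounding_number = |\<B>|"
      "\<And>\<C>. unbounded_family \<C> \<Longrightarrow> |\<B>| \<le>o |\<C>|"
    by (rule bounding_number_attained) simp
  ultimately have "|\<B>| \<le>o |h ` J|" by simp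
  moreover have "|h ` J| <o |\<B>|" using small_image[OF assms, of h] \<B>(1) unfolding small_def by simp
  ultimately show False using not_ordLess_ordLeq[of "|h ` J|" "|\<B>|"] by blast
qed

text \<open>The content is that an unbounded family is uncountable, which follows by
  diagonalization.\<close>

lemma countable_small:
  assumes "countable J"
  shows "small J"
proof -
  obtain \<B> where \<B>: "unbounded_family \<B>" "bounding_number = |\<B>|"
    by (rule bounding_number_attained)
  have "\<not> countable \<B>"
  proof
    assume c: "countable \<B>"
    have ne: "\<B> \<noteq> {}" using \<B>(1) unfolding unbounded_family_def by blast
    define e where "e = from_nat_into \<B>"
    have range_e: "range e = \<B>"
      unfolding e_def by (rule range_from_nat_into[OF ne c])
    \<comment> \<open>The maximum of the first functions at \<open>k\<close> is at least
      \<open>e i k\<close> as soon as \<open>i \<le> k\<close>.\<close>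
    define f where "f k = Max ((\<lambda>i. e i k) ` {..k})" for k
    have "e i \<le>\<^sup>* f" for i
    proof -
      have le: "e i k \<le> f k" if "i \<le> k" for k
        unfolding f_def using that by (intro Max_ge) auto
      have "{k. e i k > f k} \<subseteq> {..<i}"
      proof
        fix k assume "k \<in> {k. e i k > f k}"
        then show "k \<in> {..<i}" using le[of k] by (cases "i \<le> k") auto
      qed
      then show ?thesis unfolding eventually_le_def by (rule finite_subset) simp
    qed
    then have "\<forall>b\<in>\<B>. b \<le>\<^sup>* f" unfolding range_e[symmetric] by blast
    then show False using \<B>(1) unfolding unbounded_family_def by blast
  qed
  moreover have "countable \<B>" if le: "|\<B>| \<le>o |J|"
  proof -
    obtain h where "inj_on h \<B>" "h ` \<B> \<subseteq> J" using le unfolding card_of_ordLeq[symmetric] by blast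
    then show ?thesis using assms by (metis countable_image_inj_on countable_subset)
  qed
  ultimately have "\<not> |\<B>| \<le>o |J|" by blast
  then have "|J| <o |\<B>|"
    using not_ordLess_iff_ordLeq[OF card_of_Well_order[of \<B>] card_of_Well_order[of J]] by blast
  then show ?thesis unfolding small_def \<B>(2) .
qed

lemma small_Un:
  assumes "small I" "small J"
  shows "small (I \<union> J)"
proof -
  obtain \<B> where \<B>: "bounding_number = |\<B>|"
    by (rule bounding_number_attained)
  have "|UNIV :: nat set| <o |\<B>|"
    using countable_small[of "UNIV :: nat set"] unfolding small_def \<B> by simp
  then have "infinite \<B>"
    using card_of_ordLeq_infinite[OF ordLess_imp_ordLeq] by blast
  then show ?thesis using assms unfolding small_def \<B> by (rule card_of_Un_ordLess_infinite)
qed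

lemma small_Times_countable:
  assumes "small J" "countable X"
  shows "small (J \<times> X)"
proof -
  \<comment> \<open>Adding a copy of the naturals makes \<open>J\<close> infinite, so that squaring
    keeps the cardinality.\<close>
  let ?M = "Inl ` J \<union> range Inr :: ('a + nat) set"
  have M: "small ?M" by (intro small_Un small_image assms countable_small) simp
  have "infinite (range (Inr :: nat \<Rightarrow> 'a + nat))" by (intro range_inj_infinite inj_Inr)
  then have "infinite ?M" by simp
  then have "|?M \<times> ?M| =o |?M|" by (rule card_of_Times_same_infinite)
  then have "small (?M \<times> ?M)"
    using M unfolding small_def by (rule ordIso_ordLess_trans)
  moreover have "inj_on (\<lambda>(j, x). (Inl j, Inr (to_nat_on X x))) (J \<times> X)"
    using inj_on_to_nat_on[OF assms(2)] by (auto intro!: inj_onI dest: inj_onD)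
  moreover have "(\<lambda>(j, x). (Inl j, Inr (to_nat_on X x))) ` (J \<times> X) \<subseteq> ?M \<times> ?M"
    by (intro image_subsetI) (simp add: mem_Times_iff split_beta)
  ultimately show ?thesis by (rule small_inj)
qed

section \<open>Homogeneous sets for fewer colourings than the bounding number\<close>

text \<open>Fewer sets than the splitting number cannot form a splitting family; an enumeration of
  \<open>C\<close> transfers this from the naturals to \<open>C\<close>.\<close>

lemma small_unsplit:
  fixes C :: "nat set"
  assumes sb: "splitting_number =o bounding_number" and J: "small J" and C: "infinite C"
  obtains X where "X \<subseteq> C" "infinite X" "\<forall>j\<in>J. finite (X \<inter> S j) \<or> finite (X - S j)"
proof -
  define e where "e = enumerate C"
  have inj: "inj e" and rng: "range e = C"
    using C by (simp_all add: e_def inj_enumerate range_enumerate)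
  \<comment> \<open>Splitting families consist of infinite sets. The finite traces left out split
    nothing.\<close>
  define \<S> where "\<S> = {T \<in> (\<lambda>j. e -` S j) ` J. infinite T}"
  obtain \<T> where \<T>: "splitting_number = |\<T>|" "\<And>\<C>. splitting_family \<C> \<Longrightarrow> |\<T>| \<le>o |\<C>|"
    by (rule min_card_attained[where P = splitting_family, OF splitting_family_infinite_sets])
      (simp add: splitting_number_def)
  have "small \<S>"
    unfolding \<S>_def by (rule small_subset[OF small_image[OF J]]) blast
  then have "|\<S>| <o splitting_number"
    unfolding small_def by (rule ordLess_ordIso_trans[OF _ ordIso_symmetric[OF sb]])
  then have "\<not> splitting_family \<S>"
    using \<T>(2)[of \<S>] not_ordLess_ordLeq[of "|\<S>|" "|\<T>|"] unfolding \<T>(1) by blast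
  then obtain Y where Y: "infinite Y" "\<And>T. T \<in> \<S> \<Longrightarrow> finite (Y \<inter> T) \<or> finite (Y - T)"
    unfolding splitting_family_def by (auto simp: \<S>_def)
  show thesis
  proof (rule that)
    show "e ` Y \<subseteq> C" using rng by blast
    show "infinite (e ` Y)" using Y(1) inj by (simp add: finite_image_iff inj_on_subset)
    show "\<forall>j\<in>J. finite (e ` Y \<inter> S j) \<or> finite (e ` Y - S j)"
    proof
      fix j assume j: "j \<in> J"
      have *: "e ` Y \<inter> S j = e ` (Y \<inter> e -` S j)" "e ` Y - S j = e ` (Y - e -` S j)" by auto
      have "finite (Y \<inter> e -` S j) \<or> finite (Y - e -` S j)"
        using Y(2)[of "e -` S j"] j by (cases "finite (e -` S j)") (auto simp: \<S>_def)
      then show "finite (e ` Y \<inter> S j) \<or> finite (e ` Y - S j)"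
        unfolding * by blast
    qed
  qed
qed

text \<open>Iterate a choice of an element of \<open>C\<close> above both \<open>c\<close> and
  \<open>h c\<close>. For nonconsecutive elements the bound follows because the next element is at
  most \<open>d\<close>.\<close>

lemma sparse_subset:
  fixes C :: "nat set"
  assumes "infinite C"
  obtains D where "D \<subseteq> C" "infinite D" "\<forall>c\<in>D. \<forall>d\<in>D. c < d \<longrightarrow> h c < d"
proof -
  have "\<exists>d\<in>C. c < d \<and> h c < d" for c
    using assms infinite_nat_iff_unbounded[of C] by (metis less_trans linorder_neqE_nat)
  then obtain s where s: "\<And>c. s c \<in> C \<and> c < s c \<and> h c < s c" by metis
  define s' where "s' c = Max (s ` {..c})" for c
  have s': "s' c \<in> C" "c < s' c" "\<And>b. b \<le> c \<Longrightarrow> h b < s' c" for c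
  proof -
    have "s' c \<in> s ` {..c}" unfolding s'_def by (intro Max_in) auto
    then show "s' c \<in> C" using s by auto
    have ge: "s b \<le> s' c" if "b \<le> c" for b unfolding s'_def using that by (intro Max_ge) auto
    then show "c < s' c" "\<And>b. b \<le> c \<Longrightarrow> h b < s' c" using s by (meson less_le_trans order_refl)+
  qed
  define e where "e i = (s' ^^ Suc i) 0" for i
  have step: "e (Suc i) = s' (e i)" for i by (simp add: e_def)
  have mono: "strict_mono e" by (rule strict_monoI_Suc) (simp add: step s')
  show thesis
  proof (rule that[of "range e"])
    show "range e \<subseteq> C" using s'(1) by (auto simp: e_def)
    show "infinite (range e)" using mono by (simp add: range_inj_infinite strict_mono_imp_inj_on)
    have "h c < d" if cd: "c \<in> range e" "d \<in> range e" "c < d" for c d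
    proof -
      obtain i j where ij: "c = e i" "d = e j" "i < j"
        using cd mono by (auto simp: strict_mono_less)
      have "h c < e (Suc i)" unfolding step ij(1) by (rule s') simp
      also have "\<dots> \<le> e j" using mono ij(3) by (simp add: strict_mono_less_eq Suc_leI)
      finally show ?thesis using ij by simp
    qed
    then show "\<forall>c\<in>range e. \<forall>d\<in>range e. c < d \<longrightarrow> h c < d" by blast
  qed
qed

lemma nsets_SucE:
  fixes C :: "nat set"
  assumes "z \<in> [C]\<^bsup>Suc n\<^esup>"
  obtains x m where "x \<in> [C]\<^bsup>n\<^esup>" "z = insert m x" "m \<in> C" "\<forall>y\<in>x. y < m"
proof -
  have z: "finite z" "z \<noteq> {}" "z \<subseteq> C" "card z = Suc n" using assms by (auto simp: nsets_def)
  then have "Max z \<in> z" by (intro Max_in)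
  show thesis
  proof (rule that[of "z - {Max z}" "Max z"])
    show "z - {Max z} \<in> [C]\<^bsup>n\<^esup>" using z \<open>Max z \<in> z\<close> by (auto simp: nsets_def)
    show "z = insert (Max z) (z - {Max z})" "Max z \<in> C"
      using z(3) \<open>Max z \<in> z\<close> by blast+
    show "\<forall>y\<in>z - {Max z}. y < Max z"
      using Max_ge[OF z(1)] by (auto simp: order.strict_iff_order)
  qed
qed

text \<open>Blass's theorem that the partition numbers are at least the minimum of the bounding
  and splitting numbers.\<close>

lemma small_Ramsey:
  fixes C :: "nat set"
  assumes sb: "splitting_number =o bounding_number" and J: "small J" and C: "infinite C"
  shows "\<exists>D\<subseteq>C. infinite D \<and> (\<forall>j\<in>J. (\<forall>\<^sub>F x in cofin_nsets n D. P j x) \<or> (\<forall>\<^sub>F x in cofin_nsets n D. \<not> P j x))"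
  using C
proof (induction n arbitrary: P C)
  case 0
  have *: "x = {}" if "x \<in> [C]\<^bsup>0\<^esup>" for x using that by (auto simp: nsets_def)
  have "(\<forall>\<^sub>F x in cofin_nsets 0 C. P j x) \<or> (\<forall>\<^sub>F x in cofin_nsets 0 C. \<not> P j x)" for j
  proof (cases "P j {}")
    case True
    then show ?thesis by (intro disjI1 eventually_mono[OF eventually_cofin_nsets_in]) (auto dest: *)
  next
    case False
    then show ?thesis by (intro disjI2 eventually_mono[OF eventually_cofin_nsets_in]) (auto dest: *)
  qed
  then show ?case using 0 by blast
next
  case (Suc n)
  \<comment> \<open>With \<open>x\<close> fixed, \<open>P j (insert m x)\<close> is a property of
    \<open>m\<close>; only countably many \<open>x\<close> occur, so all these properties can be
    left unsplit at once.\<close>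
  let ?N = "{x :: nat set. finite x}"
  have "countable ?N" by (rule countable_Collect_finite)
  then have "small (J \<times> ?N)" by (intro small_Times_countable J)
  then obtain X where X: "X \<subseteq> C" "infinite X"
      "\<forall>p\<in>J \<times> ?N. finite (X \<inter> {m. P (fst p) (insert m (snd p))}) \<or> finite (X - {m. P (fst p) (insert m (snd p))})"
    by (rule small_unsplit[OF sb _ Suc.prems])
  \<comment> \<open>The limit colour: the value of \<open>P j (insert m x)\<close> for almost all
    \<open>m\<close> in \<open>X\<close>. The induction hypothesis is applied to it.\<close>
  define d where "d j x \<longleftrightarrow> finite (X - {m. P j (insert m x)})" for j x
  have "\<exists>k. \<forall>m\<in>X. k < m \<longrightarrow> (P j (insert m x) \<longleftrightarrow> d j x)" if "j \<in> J" "finite x" for j x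
  proof -
    have "finite {m \<in> X. \<not> (P j (insert m x) \<longleftrightarrow> d j x)}"
    proof (cases "d j x")
      case True
      then show ?thesis by (simp add: d_def set_diff_eq)
    next
      case False
      then have "finite (X \<inter> {m. P j (insert m x)})" using bspec[OF X(3), of "(j, x)"] that by (simp add: d_def)
      then show ?thesis using False by (simp add: Int_def)
    qed
    then obtain k where "\<forall>m\<in>{m \<in> X. \<not> (P j (insert m x) \<longleftrightarrow> d j x)}. m \<le> k"
      unfolding finite_nat_set_iff_bounded_le by blast
    then have "\<forall>m\<in>X. k < m \<longrightarrow> (P j (insert m x) \<longleftrightarrow> d j x)" using leD by blast
    then show ?thesis by blast
  qed
  then obtain k where k: "\<And>j x m. j \<in> J \<Longrightarrow> finite x \<Longrightarrow> m \<in> X \<Longrightarrow> k j x < m \<Longrightarrow> P j (insert m x) \<longleftrightarrow> d j x"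
    by metis
  obtain D where D: "D \<subseteq> X" "infinite D"
     "\<forall>j\<in>J. (\<forall>\<^sub>F x in cofin_nsets n D. d j x) \<or> (\<forall>\<^sub>F x in cofin_nsets n D. \<not> d j x)"
    using Suc.IH[OF X(2), of d] by blast
  \<comment> \<open>Making the threshold depend on \<open>Max x\<close> alone leaves one function
    for each \<open>j\<close>, so that a single \<open>G\<close> can dominate them all.\<close>
  define h where "h j t = Max (k j ` Pow {..t})" for j t
  obtain G where G: "\<forall>j\<in>J. h j \<le>\<^sup>* G" using small_bounded[OF J] by blast
  obtain D' where D': "D' \<subseteq> D" "infinite D'" "\<forall>c\<in>D'. \<forall>c'\<in>D'. c < c' \<longrightarrow> G c < c'"
    by (rule sparse_subset[OF D(2)])
  have *: "\<forall>\<^sub>F z in cofin_nsets (Suc n) D'. P j z \<longleftrightarrow> Q" if j: "j \<in> J" and Q: "\<forall>\<^sub>F x in cofin_nsets n D. d j x \<longleftrightarrow> Q" for j Q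
  proof -
    obtain F where F: "finite F" "\<forall>x\<in>[D - F]\<^bsup>n\<^esup>. d j x \<longleftrightarrow> Q"
      using Q unfolding eventually_cofin_nsets by blast
    \<comment> \<open>\<open>F\<close> secures the colour \<open>Q\<close>, the second set the
      domination by \<open>G\<close>, and the last one the case of empty \<open>x\<close>, which has
      no maximum.\<close>
    let ?H = "F \<union> {t. h j t > G t} \<union> {..k j {}}"
    have "finite ?H" using F(1) bspec[OF G j] by (simp add: eventually_le_def)
    moreover have "P j z \<longleftrightarrow> Q" if z: "z \<in> [D' - ?H]\<^bsup>Suc n\<^esup>" for z
    proof -
      obtain x m where x: "x \<in> [D' - ?H]\<^bsup>n\<^esup>" "z = insert m x" "m \<in> D' - ?H" "\<forall>y\<in>x. y < m"
        by (rule nsets_SucE[OF z])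
      have fx: "finite x" and xD: "x \<subseteq> D' - ?H" using x(1) by (auto simp: nsets_def)
      have "k j x < m"
      proof (cases "x = {}")
        case True then show ?thesis using x(3) by simp
      next
        case False
        then have "Max x \<in> x" using fx by simp
        have "k j x \<le> h j (Max x)" unfolding h_def
        proof (intro Max_ge imageI)
          show "x \<in> Pow {..Max x}" using Max_ge[OF fx] by blast
        qed simp
        also have "\<dots> \<le> G (Max x)" using \<open>Max x \<in> x\<close> xD by (auto simp: not_less)
        also have "\<dots> < m" using \<open>Max x \<in> x\<close> xD x(3,4) D'(3) by blast
        finally show ?thesis .
      qed
      moreover have "m \<in> X" using x(3) D(1) D'(1) by blast
      ultimately have "P j z \<longleftrightarrow> d j x" using k[OF j fx] unfolding x(2) by simp
      moreover have "D' - ?H \<subseteq> D - F" using D'(1) by blast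
      then have "x \<in> [D - F]\<^bsup>n\<^esup>" using x(1) nsets_mono by blast
      then have "d j x \<longleftrightarrow> Q" by (rule bspec[OF F(2)])
      ultimately show ?thesis by simp
    qed
    ultimately show ?thesis unfolding eventually_cofin_nsets by (intro exI[of _ ?H] conjI ballI)
  qed
  have "(\<forall>\<^sub>F x in cofin_nsets (Suc n) D'. P j x) \<or> (\<forall>\<^sub>F x in cofin_nsets (Suc n) D'. \<not> P j x)" if "j \<in> J" for j
    using bspec[OF D(3) that]
  proof
    assume "\<forall>\<^sub>F x in cofin_nsets n D. d j x"
    then show ?thesis using *[OF that, of True] by simp
  next
    assume "\<forall>\<^sub>F x in cofin_nsets n D. \<not> d j x"
    then show ?thesis using *[OF that, of False] by simp
  qed
  moreover have "D' \<subseteq> C" using X(1) D(1) D'(1) by blast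
  ultimately show ?case using D'(2) by blast
qed


section \<open>Levels of functions on finite sets\<close>

definition rank :: "nat set \<Rightarrow> nat \<Rightarrow> nat" where
  "rank x c = card {y \<in> x. y < c}"

lemma rank_strict_mono:
  assumes "finite x" "c \<in> x" "c < d"
  shows "rank x c < rank x d"
  unfolding rank_def using assms by (intro psubset_card_mono) auto

lemma rank_mono: "finite x \<Longrightarrow> c \<le> d \<Longrightarrow> rank x c \<le> rank x d"
  unfolding rank_def by (intro card_mono) auto

lemma rank_attained:
  assumes "finite x" "i < card x"
  obtains c where "c \<in> x" "rank x c = i"
proof -
  have inj: "inj_on (rank x) x"
    by (intro linorder_inj_onI') (use rank_strict_mono[OF assms(1)] in force)
  have "rank x ` x \<subseteq> {..<card x}"
    unfolding rank_def using assms(1) by (auto intro!: psubset_card_mono)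
  moreover have "card (rank x ` x) = card {..<card x}" using card_image[OF inj] by simp
  ultimately have "rank x ` x = {..<card x}" by (intro card_subset_eq) auto
  then show thesis using assms(2) that by (metis imageE lessThan_iff)
qed

text \<open>After thinning out, the position of \<open>u x\<close> among the elements of \<open>D\<close> depends on a
  single coordinate of \<open>x\<close>: for \<open>j > 0\<close>, if \<open>c\<close> is the \<open>j\<close>-th element of \<open>x\<close> then \<open>u x\<close> lies above all
  \<open>d < c\<close> and below all \<open>d > c\<close>, where \<open>d\<close> ranges over \<open>D - x\<close>.\<close>

definition has_level :: "nat set \<Rightarrow> nat \<Rightarrow> (nat set \<Rightarrow> nat) \<Rightarrow> nat \<Rightarrow> bool" where
  "has_level D n u j \<longleftrightarrow> (\<forall>x\<in>[D]\<^bsup>n\<^esup>. \<forall>c\<in>D - x. c \<le> u x \<longleftrightarrow> rank x c < j)"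

lemma has_levelD: "has_level D n u j \<Longrightarrow> x \<in> [D]\<^bsup>n\<^esup> \<Longrightarrow> c \<in> D - x \<Longrightarrow> c \<le> u x \<longleftrightarrow> rank x c < j"
  by (simp add: has_level_def)

text \<open>Colour \<open>Suc n\<close>-sets by whether their element of rank \<open>k\<close> is at
  most the value of \<open>u i\<close> on the rest. On a homogeneous set the answer depends on
  \<open>i\<close> and \<open>k\<close> only. It can only change from yes to no as \<open>k\<close>
  grows, and it is no for \<open>k = n\<close>; the first no is the level.\<close>

lemma levels_exist:
  fixes u :: "'i \<Rightarrow> nat set \<Rightarrow> nat"
  assumes sb: "splitting_number =o bounding_number" and I: "finite I" and C: "infinite C"
  obtains D where "D \<subseteq> C" "infinite D" "\<forall>i\<in>I. \<exists>j\<le>n. has_level D n (u i) j"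
proof -
  define P where "P = (\<lambda>(i, k) z. \<exists>c\<in>z. rank z c = k \<and> c \<le> u i (z - {c}))"
  let ?J = "I \<times> {..n}"
  have finJ: "finite ?J" using I by simp
  obtain D0 where D0: "D0 \<subseteq> C" "infinite D0" and
    hom: "\<forall>p\<in>?J. (\<forall>\<^sub>F z in cofin_nsets (Suc n) D0. P p z) \<or> (\<forall>\<^sub>F z in cofin_nsets (Suc n) D0. \<not> P p z)"
    using small_Ramsey[OF sb countable_small[OF countable_finite[OF finJ]] C, where P = P and n = "Suc n"] by blast
  define b where "b p \<longleftrightarrow> (\<forall>\<^sub>F z in cofin_nsets (Suc n) D0. P p z)" for p
  have "\<forall>\<^sub>F z in cofin_nsets (Suc n) D0. \<forall>p\<in>?J. P p z \<longleftrightarrow> b p"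
  proof (intro eventually_ball_finite finJ ballI)
    fix p assume "p \<in> ?J"
    then show "\<forall>\<^sub>F z in cofin_nsets (Suc n) D0. P p z \<longleftrightarrow> b p"
      using bspec[OF hom, of p] by (cases "b p") (simp_all add: b_def)
  qed
  then obtain F where F: "finite F" "\<forall>z\<in>[D0 - F]\<^bsup>Suc n\<^esup>. \<forall>p\<in>?J. P p z \<longleftrightarrow> b p"
    unfolding eventually_cofin_nsets by blast
  define D where "D = D0 - F"
  have infD: "infinite D" using D0(2) F(1) by (simp add: D_def)
  have le_iff: "c \<le> u i x \<longleftrightarrow> b (i, rank x c)" if i: "i \<in> I" and x: "x \<in> [D]\<^bsup>n\<^esup>" and c: "c \<in> D - x" for i x c
  proof -
    have fx: "finite x" "x \<subseteq> D" "card x = n" using x by (auto simp: nsets_def)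
    have le: "rank x c \<le> n" unfolding rank_def fx(3)[symmetric] using fx(1) by (intro card_mono) auto
    have "insert c x \<in> [D0 - F]\<^bsup>Suc n\<^esup>" using fx c by (auto simp: nsets_def D_def)
    then have *: "P (i, rank x c) (insert c x) \<longleftrightarrow> b (i, rank x c)" using F(2) i le by simp
    have rc: "rank (insert c x) c = rank x c"
      unfolding rank_def by (rule arg_cong[where f = card]) auto
    have unique: "d = c" if d: "d \<in> insert c x" "rank (insert c x) d = rank x c" for d
    proof (cases d c rule: linorder_cases)
      case less
      then show ?thesis using rank_strict_mono[of "insert c x" d c] fx(1) d rc by simp
    next
      case greater
      then show ?thesis using rank_strict_mono[of "insert c x" c d] fx(1) d rc by simp
    qed
    have rm: "insert c x - {c} = x" using c by blast
    have "P (i, rank x c) (insert c x) \<longleftrightarrow> c \<le> u i x"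
    proof
      assume "P (i, rank x c) (insert c x)"
      then obtain d where "d \<in> insert c x" "rank (insert c x) d = rank x c" "d \<le> u i (insert c x - {d})"
        unfolding P_def prod.case by blast
      then show "c \<le> u i x" using unique[of d] rm by simp
    next
      assume "c \<le> u i x"
      then show "P (i, rank x c) (insert c x)" unfolding P_def using rc rm by auto
    qed
    then show ?thesis using * by simp
  qed
  have top_false: "\<not> b (i, n)" if i: "i \<in> I" for i
  proof -
    \<comment> \<open>An element \<open>c\<close> above \<open>x\<close> and above
      \<open>u i x\<close> has rank \<open>n\<close> and answer no.\<close>
    obtain x where x: "x \<in> [D]\<^bsup>n\<^esup>" using infD nsets_eq_empty_iff[of D n] by blast
    then have fx: "finite x" "card x = n" by (auto simp: nsets_def)
    obtain c where c: "c \<in> D" "Max (insert (u i x) x) < c"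
      using infD by (metis infinite_nat_iff_unbounded)
    have big: "\<forall>y\<in>insert (u i x) x. y < c"
      using c(2) fx(1) by simp
    then have "{y \<in> x. y < c} = x" by auto
    then have "rank x c = n" unfolding rank_def using fx(2) by simp
    moreover have "\<not> c \<le> u i x" "c \<in> D - x" using big c(1) by (auto simp: not_le)
    ultimately show ?thesis using le_iff[OF i x] by metis
  qed
  have downward: "b (i, k)" if i: "i \<in> I" and k: "k < k'" "k' \<le> n" "b (i, k')" for i k k'
  proof -
    define e where "e = enumerate D"
    have e: "strict_mono e" "range e = D" using infD by (simp_all add: e_def strict_mono_enumerate range_enumerate)
    then have inj: "inj e" by (simp add: strict_mono_imp_inj_on)
    \<comment> \<open>Omitting two indices leaves one \<open>n\<close>-set against which both ranks
      can be tested: \<open>e k\<close> has rank \<open>k\<close>, and \<open>e (Suc k')\<close> has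
      rank \<open>k'\<close> because \<open>k\<close> is missing below it.\<close>
    let ?Y = "{..Suc n} - {k, Suc k'}"
    let ?x = "e ` ?Y"
    have "card ?Y = n" using k by (simp add: card_Diff_subset)
    then have x: "?x \<in> [D]\<^bsup>n\<^esup>" using e(2) card_image[OF inj_on_subset[OF inj], of ?Y] by (auto simp: nsets_def)
    have rank: "rank ?x (e m) = card {t \<in> ?Y. t < m}" for m
    proof -
      have "{y \<in> ?x. y < e m} = e ` {t \<in> ?Y. t < m}" using e(1) by (auto simp: strict_mono_less)
      then show ?thesis unfolding rank_def using card_image[OF inj_on_subset[OF inj]] by simp
    qed
    have "{t \<in> ?Y. t < k} = {..<k}" "{t \<in> ?Y. t < Suc k'} = {..<Suc k'} - {k}" using k by auto
    then have r: "rank ?x (e k) = k" "rank ?x (e (Suc k')) = k'" using k by (simp_all add: rank card_Diff_subset)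
    have in_D: "e k \<in> D - ?x" "e (Suc k') \<in> D - ?x" using e(2) inj by (auto simp: inj_eq)
    have "e k < e (Suc k')" using k e(1) by (simp add: strict_mono_less)
    also have "\<dots> \<le> u i ?x" using le_iff[OF i x in_D(2)] r k(3) by simp
    finally show ?thesis using le_iff[OF i x in_D(1)] r by simp
  qed
  have "\<exists>j\<le>n. has_level D n (u i) j" if i: "i \<in> I" for i
  proof -
    define j where "j = (LEAST k. \<not> b (i, k))"
    have j: "\<not> b (i, j)" "j \<le> n" unfolding j_def
      by (rule LeastI[of "\<lambda>k. \<not> b (i, k)"], rule top_false[OF i]) (rule Least_le, rule top_false[OF i])
    have b: "b (i, k) \<longleftrightarrow> k < j" if k: "k \<le> n" for k
    proof (cases k j rule: linorder_cases)
      case less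
      then show ?thesis using not_less_Least[of k "\<lambda>k. \<not> b (i, k)"] by (simp add: j_def)
    next
      case greater
      then show ?thesis using downward[OF i greater k] j(1) by linarith
    qed (use j(1) in simp)
    have rank: "rank x c \<le> n" if "x \<in> [D]\<^bsup>n\<^esup>" for x c
    proof -
      have "finite x" "card x = n" using that by (auto simp: nsets_def)
      then show ?thesis unfolding rank_def by (metis (no_types, lifting) card_mono mem_Collect_eq subsetI)
    qed
    have "has_level D n (u i) j"
      unfolding has_level_def using le_iff[OF i] b[OF rank] by simp
    then show ?thesis using j(2) by blast
  qed
  then have "\<forall>i\<in>I. \<exists>j\<le>n. has_level D n (u i) j" by blast
  moreover have "D \<subseteq> C" using D0(1) by (auto simp: D_def)
  ultimately show thesis using that infD by blast
qed

text \<open>At level 0 every element of \<open>D\<close> outside \<open>x\<close> exceeds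
  \<open>u x\<close>, so any fixed element of \<open>D\<close> is a bound for all \<open>x\<close>
  avoiding it.\<close>

lemma level_0_bounded:
  assumes "infinite D" "has_level D n u 0"
  shows "\<exists>m. \<forall>\<^sub>F x in cofin_nsets n D. u x \<le> m"
proof -
  obtain m where m: "m \<in> D" using assms(1) infinite_imp_nonempty by blast
  have "u x \<le> m" if "x \<in> [D - {m}]\<^bsup>n\<^esup>" for x
  proof -
    have "x \<in> [D]\<^bsup>n\<^esup>" "m \<in> D - x" using that m by (auto simp: nsets_def)
    then have "\<not> m \<le> u x" using has_levelD[OF assms(2)] by blast
    then show ?thesis by simp
  qed
  then show ?thesis unfolding eventually_cofin_nsets by (intro exI[of _ m] exI[of _ "{m}"]) auto
qed

text \<open>Both values lie in the same gap around the \<open>j\<close>-th element of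
  \<open>x\<close>. If that element is \<open>e (2 * t + 1)\<close>, then \<open>u x\<close> is at
  least \<open>e (2 * t)\<close>, hence at least \<open>t\<close>, and \<open>v x\<close> is below
  \<open>H t\<close>. So it suffices to keep the \<open>t\<close> with \<open>H t < q t\<close>. The
  bound \<open>H\<close> is chosen before \<open>q\<close>.\<close>

lemma same_level_dominated:
  assumes D: "infinite D" and j: "0 < j" "j \<le> n" and u: "has_level D n u j" and v: "has_level D n v j"
  shows "\<exists>H. \<forall>q. mono q \<longrightarrow> \<not> q \<le>\<^sup>* H \<longrightarrow> (\<exists>D'\<subseteq>D. infinite D' \<and> (\<forall>x\<in>[D']\<^bsup>n\<^esup>. v x < q (u x)))"
proof -
  define e where "e = enumerate D"
  have e: "strict_mono e" "range e = D" using D by (simp_all add: e_def strict_mono_enumerate range_enumerate)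
  then have inj: "inj e" by (simp add: strict_mono_imp_inj_on)
  show ?thesis
  proof (intro exI[of _ "\<lambda>t. e (2 * t + 2)"] allI impI)
    fix q :: "nat \<Rightarrow> nat"
    assume q: "mono q" "\<not> q \<le>\<^sup>* (\<lambda>t. e (2 * t + 2))"
    define T where "T = {t. q t > e (2 * t + 2)}"
    \<comment> \<open>only odd indices are kept, so that the neighbours of a point of \<open>x\<close> are not in \<open>x\<close>\<close>
    define D' where "D' = (\<lambda>t. e (2 * t + 1)) ` T"
    have "infinite T" using q(2) by (simp add: T_def eventually_le_def)
    moreover have "inj (\<lambda>t. e (2 * t + 1))" by (intro injI) (drule injD[OF inj], simp)
    ultimately have "infinite D'" unfolding D'_def by (simp add: finite_image_iff inj_on_subset)
    moreover have sub: "D' \<subseteq> D" using e(2) by (auto simp: D'_def)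
    moreover have "v x < q (u x)" if x: "x \<in> [D']\<^bsup>n\<^esup>" for x
    proof -
      have fx: "finite x" "x \<subseteq> D'" "card x = n" using x by (auto simp: nsets_def)
      have xD: "x \<in> [D]\<^bsup>n\<^esup>" using x sub nsets_mono by blast
      obtain c where c: "c \<in> x" "rank x c = j - 1"
        by (rule rank_attained[OF fx(1), of "j - 1"]) (use fx(3) j in simp)
      obtain t where t: "t \<in> T" "c = e (2 * t + 1)" using c(1) fx(2) by (auto simp: D'_def)
      have even: "e (2 * s) \<in> D - x" for s
      proof -
        have "e (2 * s) \<notin> D'"
        proof
          assume "e (2 * s) \<in> D'"
          then obtain t where "e (2 * s) = e (2 * t + 1)" unfolding D'_def by blast
          then have "2 * s = 2 * t + 1" by (rule injD[OF inj])
          then show False by presburger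
        qed
        then show ?thesis using fx(2) e(2) by blast
      qed
      have "rank x (e (2 * t)) \<le> rank x c" using e(1) t(2) by (intro rank_mono fx(1)) (simp add: strict_mono_less_eq)
      then have lo: "e (2 * t) \<le> u x" using has_levelD[OF u xD even] c(2) j(1) by simp
      have "rank x c < rank x (e (2 * Suc t))" using e(1) t(2) by (intro rank_strict_mono fx(1) c(1)) (simp add: strict_mono_less)
      then have "\<not> rank x (e (2 * Suc t)) < j" using c(2) by simp
      then have hi: "v x < e (2 * Suc t)" using has_levelD[OF v xD even[of "Suc t"]] by linarith
      have "t \<le> e (2 * t)" using strict_mono_imp_increasing[OF e(1), of "2 * t"] by simp
      then have "q t \<le> q (u x)" using lo by (intro monoD[OF q(1)]) simp
      then show ?thesis using hi t(1) by (simp add: T_def)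
    qed
    ultimately show "\<exists>D'\<subseteq>D. infinite D' \<and> (\<forall>x\<in>[D']\<^bsup>n\<^esup>. v x < q (u x))" by (intro exI[of _ D'] conjI ballI)
  qed
qed


section \<open>Choosing subsets with distinct nodes\<close>

definition splits :: "nat set \<Rightarrow> nat set \<Rightarrow> bool" where
  "splits T E \<longleftrightarrow> infinite (E \<inter> T) \<and> infinite (E - T)"

lemma splits_almost_superset:
  assumes "splits T E" "finite (E - F)"
  shows "splits T F"
proof -
  have "E \<inter> T \<subseteq> (F \<inter> T) \<union> (E - F)" "E - T \<subseteq> (F - T) \<union> (E - F)" by blast+
  then show ?thesis
    using assms unfolding splits_def by (meson finite_UnI finite_subset)
qed

lemma pseudo_intersection:
  fixes C :: "nat \<Rightarrow> nat set"
  assumes "decseq C" "\<And>k. infinite (C k)"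
  shows "\<exists>E\<subseteq>C 0. infinite E \<and> (\<forall>k. finite (E - C k))"
proof -
  have "\<exists>m. m \<in> C k \<and> k < m" for k
    using assms(2)[of k] unfolding infinite_nat_iff_unbounded by blast
  then obtain e where e: "\<And>k. e k \<in> C k" "\<And>k. k < e k" by metis
  have "range e \<subseteq> C 0" using e(1) decseqD[OF assms(1), of 0] by blast
  moreover have "infinite (range e)"
    unfolding infinite_nat_iff_unbounded using e(2) by blast
  moreover have "finite (range e - C k)" for k
  proof (rule finite_subset)
    show "range e - C k \<subseteq> e ` {..<k}"
    proof
      fix x assume "x \<in> range e - C k"
      then obtain i where i: "x = e i" "e i \<notin> C k" by blast
      then have "\<not> k \<le> i" using e(1)[of i] decseqD[OF assms(1), of k i] by blast
      then show "x \<in> e ` {..<k}" using i(1) by simp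
    qed
  qed simp
  ultimately show ?thesis by blast
qed

text \<open>Recursion along a well order of cardinal type: before stage \<open>i\<close> fewer
  values have been used than \<open>X i\<close> has elements.\<close>

lemma injective_choice:
  fixes X :: "'i \<Rightarrow> 'b set"
  assumes "\<And>i. |UNIV :: 'i set| \<le>o |X i|"
  shows "\<exists>f. inj f \<and> (\<forall>i. f i \<in> X i)"
proof -
  define r where "r = |UNIV :: 'i set|"
  have r: "Card_order r" "Well_order r" "Field r = UNIV"
    unfolding r_def by (rule card_of_Card_order card_of_Well_order Field_card_of)+
  have wf: "wf (r - Id)" using r(2) by (simp add: well_order_on_def)
  define P where "P f i b \<longleftrightarrow> b \<in> X i \<and> b \<notin> f ` underS r i" for f i b
  have "\<exists>f. \<forall>i. P f i (f i)"
  proof (rule dependent_wf_choice[OF wf])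
    fix f g :: "'i \<Rightarrow> 'b" and i b
    assume "\<And>z. (z, i) \<in> r - Id \<Longrightarrow> f z = g z"
    then have "f ` underS r i = g ` underS r i" by (intro image_cong) (auto simp: underS_def)
    then show "P f i b = P g i b" by (simp add: P_def)
  next
    fix i and f :: "'i \<Rightarrow> 'b"
    have "|f ` underS r i| <o r"
      by (rule ordLeq_ordLess_trans[OF card_of_image card_of_underS[OF r(1)]]) (simp add: r(3))
    then have "|f ` underS r i| <o |X i|"
      using assms[of i] unfolding r_def by (rule ordLess_ordLeq_trans)
    then have "\<not> X i \<subseteq> f ` underS r i"
      using card_of_mono1[of "X i" "f ` underS r i"] not_ordLess_ordLeq[of "|f ` underS r i|" "|X i|"] by blast
    then show "\<exists>b. P f i b" unfolding P_def by blast
  qed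
  then obtain f where f: "\<And>i. f i \<in> X i" "\<And>i. f i \<notin> f ` underS r i" unfolding P_def by blast
  have "inj f"
  proof (rule injI)
    fix i j assume eq: "f i = f j"
    have "(i, j) \<in> r \<or> (j, i) \<in> r \<or> i = j"
      using r(2,3) unfolding well_order_on_def linear_order_on_def total_on_def by auto
    then have "i \<in> underS r j \<or> j \<in> underS r i \<or> i = j" unfolding underS_def by blast
    moreover have "i \<notin> underS r j" using f(2)[of j] unfolding eq[symmetric] by blast
    moreover have "j \<notin> underS r i" using f(2)[of i] unfolding eq by blast
    ultimately show "i = j" by blast
  qed
  then show ?thesis using f(1) by blast
qed

section \<open>Sets of fast-growing tuples\<close>

text \<open>Straddling \<open>T\<close> with coordinates 0 and 1 serves almost disjointness, the
  growth above \<open>G\<close> serves the avoidance argument, and distinct first coordinates make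
  sets of tuples with a bounded coordinate finite.\<close>

definition sparse_lists :: "nat \<Rightarrow> nat set \<Rightarrow> nat set \<Rightarrow> (nat \<Rightarrow> nat) \<Rightarrow> nat list set \<Rightarrow> bool" where
  "sparse_lists n E T G A \<longleftrightarrow> infinite A \<and> inj_on (\<lambda>y. y ! 0) A \<and>
     (\<forall>y\<in>A. length y = Suc n \<and> set y \<subseteq> E \<and> y ! 0 \<in> T \<and> y ! 1 \<notin> T \<and>
       (\<forall>i j. i < j \<longrightarrow> j \<le> n \<longrightarrow> y ! i < y ! j \<and> G (y ! i) < y ! j))"

lemma sparse_lists_exist:
  assumes "splits T E" "n \<ge> 1"
  shows "\<exists>A. sparse_lists n E T G A"
proof -
  have "\<exists>e. e \<in> E - T \<and> (\<forall>t\<le>m. t < e \<and> G t < e)" for m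
  proof -
    obtain e where "e \<in> E - T" "Max ({..m} \<union> G ` {..m}) < e"
      using assms(1) unfolding splits_def infinite_nat_iff_unbounded by blast
    then show ?thesis by (intro exI[of _ e]) simp
  qed
  then obtain s where "\<forall>m. s m \<in> E - T \<and> (\<forall>t\<le>m. t < s m \<and> G t < s m)" by metis
  then have s: "s m \<in> E - T" "t \<le> m \<Longrightarrow> t < s m \<and> G t < s m" for m t by blast+
  \<comment> \<open>Each \<open>m\<close> in \<open>E \<inter> T\<close> starts one tuple, continued
    inside \<open>E - T\<close>. Since \<open>s m\<close> exceeds \<open>G\<close> on all of
    \<open>{..m}\<close>, nonadjacent coordinates are controlled without monotonicity of
    \<open>G\<close>.\<close>
  define y where "y m = map (\<lambda>i. (s ^^ i) m) [0..<Suc n]" for m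
  have nth: "y m ! i = (s ^^ i) m" if "i \<le> n" for m i
    using that unfolding y_def by (subst nth_map) (simp_all del: upt_Suc)
  have mono: "(s ^^ i) m \<le> (s ^^ j) m" if "i \<le> j" for i j m
    using lift_Suc_mono_le[of "\<lambda>i. (s ^^ i) m" i j] that s(2) by (simp add: less_imp_le)
  have step: "(s ^^ i) m < (s ^^ j) m \<and> G ((s ^^ i) m) < (s ^^ j) m" if ij: "i < j" for i j m
  proof -
    obtain k where k: "j = Suc k" "i \<le> k" using ij by (cases j) auto
    show ?thesis using s(2)[OF mono[OF k(2), of m]] k(1) by simp
  qed
  have inE: "(s ^^ i) m \<in> E" if "m \<in> E" for i m using that s(1) by (cases i) auto
  have inj: "inj_on y (E \<inter> T)"
  proof (rule inj_onI)
    fix m m' assume "y m = y m'"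
    then have "y m ! 0 = y m' ! 0" by (rule arg_cong)
    then show "m = m'" unfolding nth[OF le0] by simp
  qed
  have "sparse_lists n E T G (y ` (E \<inter> T))"
    unfolding sparse_lists_def
  proof (intro conjI ballI)
    show "infinite (y ` (E \<inter> T))"
      using assms(1) inj by (simp add: splits_def finite_image_iff)
    show "inj_on (\<lambda>y. y ! 0) (y ` (E \<inter> T))"
      by (intro inj_onI) (clarsimp simp: nth[of 0])
  next
    fix z assume "z \<in> y ` (E \<inter> T)"
    then obtain m where m: "m \<in> E" "m \<in> T" "z = y m" by blast
    show "length z = Suc n" using m(3) by (simp add: y_def)
    show "set z \<subseteq> E" using m(1) inE unfolding m(3) y_def by auto
    show "z ! 0 \<in> T" using m nth[of 0 m] by simp
    show "z ! 1 \<notin> T" using m nth[of 1 m] assms(2) s(1) by simp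
    show "\<forall>i j. i < j \<longrightarrow> j \<le> n \<longrightarrow> z ! i < z ! j \<and> G (z ! i) < z ! j"
      using step nth unfolding m(3) by simp
  qed
  then show ?thesis by blast
qed

lemma sparse_listsD:
  assumes "sparse_lists n E T G A"
  shows "infinite A" "inj_on (\<lambda>y. y ! 0) A"
    and "y \<in> A \<Longrightarrow> length y = Suc n"
    and "y \<in> A \<Longrightarrow> i \<le> n \<Longrightarrow> y ! i \<in> E"
    and "y \<in> A \<Longrightarrow> y ! 0 \<in> T"
    and "y \<in> A \<Longrightarrow> y ! 1 \<notin> T"
    and "y \<in> A \<Longrightarrow> i < j \<Longrightarrow> j \<le> n \<Longrightarrow> y ! i < y ! j"
    and "y \<in> A \<Longrightarrow> i < j \<Longrightarrow> j \<le> n \<Longrightarrow> G (y ! i) < y ! j"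
proof -
  show "infinite A" "inj_on (\<lambda>y. y ! 0) A" using assms unfolding sparse_lists_def by blast+
  assume "y \<in> A"
  then have y: "length y = Suc n" "set y \<subseteq> E" "y ! 0 \<in> T" "y ! 1 \<notin> T"
      "\<And>i j. i < j \<Longrightarrow> j \<le> n \<Longrightarrow> y ! i < y ! j \<and> G (y ! i) < y ! j"
    using assms unfolding sparse_lists_def by blast+
  show "length y = Suc n" "y ! 0 \<in> T" "y ! 1 \<notin> T" by (rule y)+
  show "y ! i \<in> E" if "i \<le> n"
    using subsetD[OF y(2) nth_mem[of i y]] that y(1) by simp
  show "y ! i < y ! j" "G (y ! i) < y ! j" if "i < j" "j \<le> n"
    using y(5)[OF that] by simp_all
qed

text \<open>Tuples increase, so the bound passes to the first coordinate, which determines the tuple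
  within \<open>A\<close>.\<close>

lemma sparse_lists_finite_le:
  assumes A: "sparse_lists n E T G A" and i: "i \<le> n"
  shows "finite {y \<in> A. y ! i \<le> m}"
proof (rule finite_imageD)
  show "finite ((\<lambda>y. y ! 0) ` {y \<in> A. y ! i \<le> m})"
  proof (rule finite_subset)
    show "(\<lambda>y. y ! 0) ` {y \<in> A. y ! i \<le> m} \<subseteq> {..m}"
    proof clarify
      fix y assume y: "y \<in> A" "y ! i \<le> m"
      show "y ! 0 \<le> m"
        using sparse_listsD(7)[OF A y(1), of 0 i] i y(2) by (cases "i = 0") auto
    qed
  qed simp
  show "inj_on (\<lambda>y. y ! 0) {y \<in> A. y ! i \<le> m}"
    using sparse_listsD(2)[OF A] by (rule inj_on_subset) blast
qed

lemma sparse_lists_finite_in: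
  assumes A: "sparse_lists n E T G A" and i: "i \<le> n" and Z: "finite (E \<inter> Z)"
  shows "finite {y \<in> A. y ! i \<in> Z}"
proof -
  obtain m where "\<forall>k\<in>E \<inter> Z. k \<le> m" using Z unfolding finite_nat_set_iff_bounded_le by blast
  then have "{y \<in> A. y ! i \<in> Z} \<subseteq> {y \<in> A. y ! i \<le> m}"
    using sparse_listsD(4)[OF A _ i] by blast
  then show ?thesis using sparse_lists_finite_le[OF A i] finite_subset by blast
qed

text \<open>Since \<open>y ! j\<close> exceeds \<open>G (y ! i)\<close>, such a tuple has
  \<open>y ! i\<close> in the finite set where \<open>h\<close> exceeds \<open>G\<close>.\<close>

lemma sparse_lists_finite_dominated:
  assumes A: "sparse_lists n E T G A" and ij: "i < j" "j \<le> n" and h: "h \<le>\<^sup>* G"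
  shows "finite {y \<in> A. y ! j \<le> h (y ! i)}"
proof (rule finite_subset)
  show "{y \<in> A. y ! j \<le> h (y ! i)} \<subseteq> {y \<in> A. y ! i \<in> {k. h k > G k}}"
    using sparse_listsD(8)[OF A _ ij] by fastforce
  show "finite {y \<in> A. y ! i \<in> {k. h k > G k}}"
    using ij h by (intro sparse_lists_finite_in[OF A]) (auto simp: eventually_le_def)
qed

section \<open>Nodes of infinite sets\<close>

text \<open>One well order with small initial segments indexes both an unbounded and a splitting
  family; the equality of the two cardinals makes this possible.\<close>

locale splitting_bounding =
  fixes r :: "'k rel" and g :: "'k \<Rightarrow> nat \<Rightarrow> nat" and S :: "'k \<Rightarrow> nat set"
  assumes sb: "splitting_number =o bounding_number"
    and wo: "Well_order r"
    and small_underS: "k \<in> Field r \<Longrightarrow> small (underS r k)"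
    and mono_g: "mono (g k)"
    and unbounded_g: "\<exists>k\<in>Field r. \<not> g k \<le>\<^sup>* f"
    and splitting: "infinite E \<Longrightarrow> \<exists>k\<in>Field r. splits (S k) E"
begin

lemma underS_total: "j \<in> Field r \<Longrightarrow> k \<in> Field r \<Longrightarrow> j \<noteq> k \<Longrightarrow> j \<in> underS r k \<or> k \<in> underS r j"
  using wo unfolding well_order_on_def linear_order_on_def total_on_def underS_def by auto

definition split_index :: "nat set \<Rightarrow> 'k" where
  "split_index E = (SOME k. k \<in> Field r \<and> splits (S k) E \<and> (\<forall>j\<in>underS r k. \<not> splits (S j) E))"

lemma split_index:
  assumes "infinite E"
  shows "split_index E \<in> Field r" "splits (S (split_index E)) E"
    and "j \<in> underS r (split_index E) \<Longrightarrow> \<not> splits (S j) E"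
proof -
  let ?Q = "{k \<in> Field r. splits (S k) E}"
  have wf: "wf (r - Id)" using wo by (simp add: well_order_on_def)
  obtain i where "i \<in> ?Q" using splitting[OF assms] by blast
  then have "\<exists>k\<in>?Q. \<forall>j. (j, k) \<in> r - Id \<longrightarrow> j \<notin> ?Q"
    by (rule wf[unfolded wf_eq_minimal, rule_format])
  then obtain k where k: "k \<in> ?Q" "\<forall>j. (j, k) \<in> r - Id \<longrightarrow> j \<notin> ?Q" by blast
  have "\<not> splits (S j) E" if "j \<in> underS r k" for j
    using spec[OF k(2), of j] that FieldI1[of j k r] unfolding underS_def by blast
  then have "\<exists>k. k \<in> Field r \<and> splits (S k) E \<and> (\<forall>j\<in>underS r k. \<not> splits (S j) E)" using k(1) by blast
  from someI_ex[OF this] show "split_index E \<in> Field r" "splits (S (split_index E)) E"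
    "j \<in> underS r (split_index E) \<Longrightarrow> \<not> splits (S j) E"
    unfolding split_index_def by blast+
qed

text \<open>Sets before the split index do not split \<open>E\<close>, so each almost contains or
  almost misses \<open>E\<close>; the second component records which. This is the branch of
  \<open>E\<close> in a binary tree.\<close>

definition node :: "nat set \<Rightarrow> 'k \<times> 'k set" where
  "node E = (split_index E, {k \<in> underS r (split_index E). finite (E - S k)})"

lemma node_neqI:
  assumes "infinite E'" "k \<in> underS r (split_index E)" "finite (E - S k)" "finite (E' \<inter> S k)"
  shows "node E \<noteq> node E'"
proof
  have "k \<in> snd (node E)" using assms(2,3) by (simp add: node_def)
  also assume "node E = node E'"
  finally have "finite (E' - S k)" by (simp add: node_def)
  then have "finite E'" using assms(4) by (metis Diff_Diff_Int finite_Diff2)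
  then show False using assms(1) by simp
qed

text \<open>The nodes differ at some \<open>k\<close> below the common index. As \<open>S k\<close>
  splits neither set, the two lie almost on opposite sides of it.\<close>

lemma node_neqE:
  assumes "infinite E" "infinite E'" "node E \<noteq> node E'" "split_index E = split_index E'"
  obtains k where "k \<in> underS r (split_index E)"
    "finite (E - S k) \<and> finite (E' \<inter> S k) \<or> finite (E' - S k) \<and> finite (E \<inter> S k)"
proof -
  obtain k where k: "k \<in> underS r (split_index E)" "finite (E - S k) \<noteq> finite (E' - S k)"
    using assms(3,4) unfolding node_def by auto
  have "\<not> splits (S k) E" "\<not> splits (S k) E'"
    using split_index(3)[OF assms(1)] split_index(3)[OF assms(2)] k(1) assms(4) by auto
  then show thesis using that[OF k(1)] k(2) unfolding splits_def by blast
qed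

text \<open>Starting from \<open>B\<close>, repeatedly cut the current set by the first set
  splitting it and keep the side prescribed by \<open>p\<close>. Pseudo-intersections along
  different \<open>p\<close> lie on opposite sides at the first disagreement.\<close>

lemma many_nodes:
  assumes B: "infinite B"
  shows "|UNIV :: nat set set| \<le>o |node ` {E. E \<subseteq> B \<and> infinite E}|"
proof -
  define br :: "nat set \<Rightarrow> nat \<Rightarrow> nat set" where
    "br p = rec_nat B (\<lambda>k X. if k \<in> p then X \<inter> S (split_index X) else X - S (split_index X))" for p
  have br_0: "br p 0 = B"
    and br_Suc: "br p (Suc k) = (if k \<in> p then br p k \<inter> S (split_index (br p k)) else br p k - S (split_index (br p k)))" for p k
    by (simp_all add: br_def)
  have inf: "infinite (br p k)" for p k
  proof (induction k)
    case (Suc k)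
    then show ?case using split_index(2)[OF Suc] by (simp add: br_Suc splits_def)
  qed (simp add: br_0 B)
  have dec: "decseq (br p)" for p by (rule decseq_SucI) (auto simp: br_Suc)
  have "\<forall>p. \<exists>E\<subseteq>B. infinite E \<and> (\<forall>k. finite (E - br p k))"
    using pseudo_intersection[OF dec inf] by (simp add: br_0)
  then obtain E where E: "\<And>p. E p \<subseteq> B" "\<And>p. infinite (E p)" "\<And>p k. finite (E p - br p k)" by metis
  have neq: "node (E p) \<noteq> node (E q)" if pq: "k \<in> p" "k \<notin> q" "\<forall>i<k. i \<in> p \<longleftrightarrow> i \<in> q" for k p q
  proof -
    have "i \<le> k \<Longrightarrow> br p i = br q i" for i
      using pq(3) by (induction i) (simp_all add: br_0 br_Suc)
    then have eq: "br q k = br p k" by simp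
    let ?X = "br p k"
    let ?k = "split_index ?X" and ?l = "split_index (E p)"
    have fin: "finite (E p - S ?k)" "finite (E q \<inter> S ?k)"
    proof -
      show "finite (E p - S ?k)"
        by (rule finite_subset[OF _ E(3)[of p "Suc k"]]) (use pq(1) in \<open>simp add: br_Suc, blast\<close>)
      show "finite (E q \<inter> S ?k)"
        by (rule finite_subset[OF _ E(3)[of q "Suc k"]]) (use pq(2) in \<open>simp add: br_Suc eq, blast\<close>)
    qed
    \<comment> \<open>The index of \<open>E p\<close> is strictly above \<open>?k\<close>:
      \<open>S ?k\<close> does not split \<open>E p\<close>, and an earlier set splitting
      \<open>E p\<close> would also split \<open>?X\<close>, which almost contains it.\<close>
    note l = split_index[OF E(2)[of p]]
    have "?l \<noteq> ?k" using l(2) fin(1) unfolding splits_def by metis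
    moreover have "?l \<notin> underS r ?k"
      using split_index(3)[OF inf] splits_almost_superset[OF l(2) E(3)] by blast
    ultimately have "?k \<in> underS r ?l" using underS_total[OF l(1) split_index(1)[OF inf]] by blast
    then show ?thesis using fin by (intro node_neqI E(2))
  qed
  have "inj (\<lambda>p. node (E p))"
  proof (rule injI, rule ccontr)
    fix p q assume eq: "node (E p) = node (E q)" and "p \<noteq> q"
    then have ex: "\<exists>k. (k \<in> p) \<noteq> (k \<in> q)" by blast
    define k where "k = (LEAST k. (k \<in> p) \<noteq> (k \<in> q))"
    have k: "(k \<in> p) \<noteq> (k \<in> q)" unfolding k_def by (rule LeastI_ex[OF ex])
    have less: "\<forall>i<k. i \<in> p \<longleftrightarrow> i \<in> q" using not_less_Least unfolding k_def by blast
    show False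
      using k neq[of k p q] neq[of k q p] less eq by auto
  qed
  moreover have "range (\<lambda>p. node (E p)) \<subseteq> node ` {E. E \<subseteq> B \<and> infinite E}" using E(1,2) by blast
  ultimately show ?thesis by (intro card_of_ordLeq[THEN iffD1] exI conjI)
qed

lemma family_exists:
  assumes n: "n \<ge> 1"
  shows "\<exists>E A G. (\<forall>B. infinite (E B)) \<and> (\<forall>B. infinite B \<longrightarrow> E B \<subseteq> B) \<and> inj (\<lambda>B. node (E B)) \<and>
    (\<forall>B. sparse_lists n (E B) (S (split_index (E B))) (G B) (A B)) \<and>
    (\<forall>B. \<forall>k\<in>underS r (split_index (E B)). g k \<le>\<^sup>* G B)"
proof -
  \<comment> \<open>A finite \<open>B\<close> gets \<open>UNIV\<close> as a default, so that the
    family is indexed by all sets of naturals and has size continuum.\<close>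
  define X where "X B = node ` {E. E \<subseteq> (if infinite B then B else UNIV) \<and> infinite E}" for B
  have "|UNIV :: nat set set| \<le>o |X B|" for B
    unfolding X_def by (rule many_nodes) simp
  then obtain N where N: "inj N" "\<forall>B. N B \<in> X B" using injective_choice[of X] by blast
  then have "\<forall>B. \<exists>E. N B = node E \<and> E \<subseteq> (if infinite B then B else UNIV) \<and> infinite E"
    unfolding X_def by blast
  then obtain E where E: "\<And>B. N B = node (E B)" "\<And>B. E B \<subseteq> (if infinite B then B else UNIV)" "\<And>B. infinite (E B)"
    by metis
  have "\<forall>B. \<exists>G. \<forall>k\<in>underS r (split_index (E B)). g k \<le>\<^sup>* G"
    using small_bounded[OF small_underS[OF split_index(1)[OF E(3)]]] by blast
  then obtain G where G: "\<forall>B. \<forall>k\<in>underS r (split_index (E B)). g k \<le>\<^sup>* G B" by metis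
  have "\<forall>B. \<exists>A. sparse_lists n (E B) (S (split_index (E B))) (G B) A"
    using sparse_lists_exist[OF split_index(2)[OF E(3)] n] by blast
  then obtain A where A: "\<forall>B. sparse_lists n (E B) (S (split_index (E B))) (G B) (A B)" by metis
  have "N = (\<lambda>B. node (E B))" using E(1) by blast
  then have "inj (\<lambda>B. node (E B))" using N(1) by simp
  moreover have "\<forall>B. infinite B \<longrightarrow> E B \<subseteq> B" using E(2) by metis
  ultimately show ?thesis using E(3) A G by blast
qed

end


section \<open>The Franklin space of the family\<close>

lemma topspace_franklin_space:
  assumes "almost_disjoint_family N \<A>"
  shows "topspace (franklin_space N \<A>) = insert None (Some ` (N <+> \<A>))"
  unfolding franklin_space_def topspace_Alexandroff_compactification topspace_isbell_mrowka_space[OF assms] ..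

lemma openin_franklin_space_Some:
  "openin (isbell_mrowka_space N \<A>) V \<Longrightarrow> openin (franklin_space N \<A>) (Some ` V)"
  unfolding franklin_space_def openin_Alexandroff_compactification by blast

text \<open>A basic neighbourhood of infinity excludes only finitely many members and finitely many
  points, so finitely many hypotheses combine.\<close>

lemma limitin_franklin_None:
  assumes ad: "almost_disjoint_family N \<A>"
    and \<A>: "\<forall>A\<in>\<A>. \<forall>\<^sub>F x in \<F>. f x \<noteq> Some (Inr A) \<and> f x \<notin> Some ` Inl ` A"
    and N: "\<forall>s\<in>N. \<forall>\<^sub>F x in \<F>. f x \<noteq> Some (Inl s)"
    and top: "\<forall>\<^sub>F x in \<F>. f x \<in> topspace (franklin_space N \<A>)"
  shows "limitin (franklin_space N \<A>) f None \<F>"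
  unfolding limitin_def
proof (intro conjI allI impI)
  show "None \<in> topspace (franklin_space N \<A>)" by (simp add: topspace_franklin_space[OF ad])
  fix U assume "openin (franklin_space N \<A>) U \<and> None \<in> U"
  then obtain \<A>\<^sub>0 F where fin: "finite \<A>\<^sub>0" "\<A>\<^sub>0 \<subseteq> \<A>" "finite F" "F \<subseteq> N"
    and U: "franklin_nbhd N \<A> \<A>\<^sub>0 F \<subseteq> U"
    using franklin_nbhd_base[OF ad] by metis
  have "\<forall>\<^sub>F x in \<F>. \<forall>A\<in>\<A>\<^sub>0. f x \<noteq> Some (Inr A) \<and> f x \<notin> Some ` Inl ` A"
    using \<A> fin(2) by (intro eventually_ball_finite fin(1)) blast
  moreover have "\<forall>\<^sub>F x in \<F>. \<forall>s\<in>F. f x \<noteq> Some (Inl s)"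
    using N fin(4) by (intro eventually_ball_finite fin(3)) blast
  ultimately show "\<forall>\<^sub>F x in \<F>. f x \<in> U"
    using top
  proof eventually_elim
    case (elim x)
    have "f x \<in> franklin_nbhd N \<A> \<A>\<^sub>0 F"
    proof (cases "f x")
      case None
      then show ?thesis by (simp add: franklin_nbhd_def)
    next
      case (Some z)
      show ?thesis
      proof (cases z)
        case (Inl s)
        have "s \<in> N" "s \<notin> F" "\<forall>A\<in>\<A>\<^sub>0. s \<notin> A"
          using elim Some Inl unfolding topspace_franklin_space[OF ad] by auto
        then show ?thesis using Some Inl unfolding franklin_nbhd_def by blast
      next
        case (Inr A)
        have "A \<in> \<A>" "A \<notin> \<A>\<^sub>0"
          using elim Some Inr unfolding topspace_franklin_space[OF ad] by auto
        then show ?thesis using Some Inr unfolding franklin_nbhd_def by blast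
      qed
    qed
    then show ?case using U by blast
  qed
qed

lemma limitin_franklin_Inr:
  assumes ad: "almost_disjoint_family N \<A>" and A: "A \<in> \<A>"
    and f: "\<forall>\<^sub>F x in \<F>. f x \<in> Some ` Inl ` A"
    and N: "\<forall>s\<in>N. \<forall>\<^sub>F x in \<F>. f x \<noteq> Some (Inl s)"
  shows "limitin (franklin_space N \<A>) f (Some (Inr A)) \<F>"
  unfolding limitin_def
proof (intro conjI allI impI)
  show "Some (Inr A) \<in> topspace (franklin_space N \<A>)"
    using A unfolding topspace_franklin_space[OF ad] by blast
  fix U assume U: "openin (franklin_space N \<A>) U \<and> Some (Inr A) \<in> U"
  \<comment> \<open>Both kinds of open sets of the compactification contain an open set of the
    Isbell-Mrowka space around \<open>A\<close>.\<close>
  have "\<exists>V. openin (isbell_mrowka_space N \<A>) V \<and> Inr A \<in> V \<and> Some ` V \<subseteq> U"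
    using conjunct1[OF U] unfolding franklin_space_def openin_Alexandroff_compactification
  proof
    assume "\<exists>V. openin (isbell_mrowka_space N \<A>) V \<and> U = Some ` V"
    then show ?thesis using U by blast
  next
    assume "\<exists>C. compactin (isbell_mrowka_space N \<A>) C \<and> closedin (isbell_mrowka_space N \<A>) C \<and>
      U = insert None (Some ` (topspace (isbell_mrowka_space N \<A>) - C))"
    then show ?thesis using U by (blast intro: openin_diff openin_topspace)
  qed
  then obtain V where V: "openin (isbell_mrowka_space N \<A>) V" "Inr A \<in> V" "Some ` V \<subseteq> U" by blast
  then obtain F where F: "finite F" "F \<subseteq> N" "Inl ` (A - F) \<subseteq> V"
    using A unfolding openin_isbell_mrowka_space by blast
  have "\<forall>\<^sub>F x in \<F>. \<forall>s\<in>F. f x \<noteq> Some (Inl s)"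
    using N F(2) by (intro eventually_ball_finite F(1)) blast
  with f show "\<forall>\<^sub>F x in \<F>. f x \<in> U"
  proof eventually_elim
    case (elim x)
    then obtain s where "s \<in> A - F" "f x = Some (Inl s)" by blast
    then show ?case using F(3) V(3) by blast
  qed
qed

lemma eventually_notin_finite:
  assumes "\<And>s. \<forall>\<^sub>F x in \<F>. l x \<noteq> s" "finite Z"
  shows "\<forall>\<^sub>F x in \<F>. l x \<notin> Z"
proof -
  have "\<forall>\<^sub>F x in \<F>. \<forall>s\<in>Z. l x \<noteq> s" using assms by (intro eventually_ball_finite) auto
  then show ?thesis by (rule eventually_mono) blast
qed

section \<open>Almost disjointness and size of the family\<close>

locale sparse_list_family = splitting_bounding r g S
  for r :: "'k rel" and g :: "'k \<Rightarrow> nat \<Rightarrow> nat" and S :: "'k \<Rightarrow> nat set" +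
  fixes n :: nat and E :: "nat set \<Rightarrow> nat set" and A :: "nat set \<Rightarrow> nat list set" and G :: "nat set \<Rightarrow> nat \<Rightarrow> nat"
  assumes n: "n \<ge> 1"
    and inf_E: "infinite (E B)"
    and E_subset: "infinite B \<Longrightarrow> E B \<subseteq> B"
    and inj_node: "inj (\<lambda>B. node (E B))"
    and sparse: "sparse_lists n (E B) (S (split_index (E B))) (G B) (A B)"
    and dominated: "k \<in> underS r (split_index (E B)) \<Longrightarrow> g k \<le>\<^sup>* G B"
begin

abbreviation "N \<equiv> {xs :: nat list. length xs = n + 1}"

text \<open>A tuple of \<open>A B'\<close> has coordinates on both sides of a set that does not split \<open>E B\<close>.\<close>

lemma finite_Int_underS:
  assumes "split_index (E B') \<in> underS r (split_index (E B))"
  shows "finite (A B \<inter> A B')"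
proof -
  let ?T = "S (split_index (E B'))"
  have "\<not> splits ?T (E B)" using split_index(3)[OF inf_E] assms by blast
  then consider "finite (E B \<inter> ?T)" | "finite (E B \<inter> - ?T)" unfolding splits_def Diff_eq by blast
  then show ?thesis
  proof cases
    case 1
    have "A B \<inter> A B' \<subseteq> {y \<in> A B. y ! 0 \<in> ?T}" using sparse_listsD(5)[OF sparse[of B']] by blast
    then show ?thesis by (rule finite_subset) (rule sparse_lists_finite_in[OF sparse le0 1])
  next
    case 2
    have "A B \<inter> A B' \<subseteq> {y \<in> A B. y ! 1 \<in> - ?T}" using sparse_listsD(6)[OF sparse[of B']] by blast
    then show ?thesis by (rule finite_subset) (rule sparse_lists_finite_in[OF sparse n 2])
  qed
qed

lemma finite_Int_separated:
  assumes "finite (E B - S k)" "finite (E B' \<inter> S k)"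
  shows "finite (A B \<inter> A B')"
proof (rule finite_subset)
  show "A B \<inter> A B' \<subseteq> {y \<in> A B. y ! 0 \<in> - S k} \<union> {y \<in> A B'. y ! 0 \<in> S k}" by blast
  show "finite ({y \<in> A B. y ! 0 \<in> - S k} \<union> {y \<in> A B'. y ! 0 \<in> S k})"
    using assms by (intro finite_UnI sparse_lists_finite_in[OF sparse le0]) (simp_all add: Diff_eq)
qed

text \<open>With equal split indices the distinct nodes put the two sets on opposite sides of some
  \<open>S k\<close>; otherwise the set at the smaller index does not split the other one.\<close>

lemma finite_Int_A:
  assumes "B \<noteq> B'"
  shows "finite (A B \<inter> A B')"
proof (cases "split_index (E B) = split_index (E B')")
  case True
  have "node (E B) \<noteq> node (E B')" using assms injD[OF inj_node] by blast
  then obtain k where "finite (E B - S k) \<and> finite (E B' \<inter> S k) \<or> finite (E B' - S k) \<and> finite (E B \<inter> S k)"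
    using node_neqE[OF inf_E inf_E _ True] by metis
  then show ?thesis using finite_Int_separated[of B k B'] finite_Int_separated[of B' k B]
    by (auto simp: Int_commute)
next
  case False
  then have "split_index (E B) \<in> underS r (split_index (E B')) \<or> split_index (E B') \<in> underS r (split_index (E B))"
    by (intro underS_total split_index(1) inf_E)
  then show ?thesis using finite_Int_underS[of B B'] finite_Int_underS[of B' B] by (auto simp: Int_commute)
qed

lemma inj_A: "inj A"
proof (rule injI, rule ccontr)
  fix B B' assume eq: "A B = A B'" and "B \<noteq> B'"
  then have "finite (A B \<inter> A B')" by (intro finite_Int_A)
  then show False using sparse_listsD(1)[OF sparse[of B]] eq by simp
qed

lemma almost_disjoint: "almost_disjoint_family N (range A)"
  unfolding almost_disjoint_family_def
proof (intro conjI ballI pairwiseI)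
  fix X assume "X \<in> range A"
  then obtain B where "X = A B" by blast
  then show "X \<subseteq> N" "infinite X" using sparse_listsD(1,3)[OF sparse[of B]] by auto
next
  fix X Y assume XY: "X \<in> range A" "Y \<in> range A" "X \<noteq> Y"
  then obtain B B' where "X = A B" "Y = A B'" by blast
  then show "finite (X \<inter> Y)" using finite_Int_A[of B B'] XY(3) by blast
qed

lemma card_range_A: "|range A| =o |UNIV :: real set|"
proof -
  have "bij_betw A UNIV (range A)" using inj_A by (rule inj_on_imp_bij_betw)
  then have "|range A| =o |UNIV :: nat set set|" by (rule ordIso_symmetric[OF card_of_ordIsoI])
  also have "|UNIV :: nat set set| =o |UNIV :: real set|"
    using nat_sets_eqpoll_reals unfolding eqpoll_iff_card_of_ordIso .
  finally show ?thesis .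
qed

section \<open>Sequential compactness in dimension \<open>n\<close>\<close>

lemma in_or_eventually_avoids:
  fixes C :: "nat set"
  assumes C: "infinite C" and l: "\<And>s. \<forall>\<^sub>F x in cofin_nsets n C. l x \<noteq> s"
  shows "\<exists>D\<subseteq>C. infinite D \<and>
    ((\<exists>B. \<forall>\<^sub>F x in cofin_nsets n D. l x \<in> A B) \<or> (\<forall>B. \<forall>\<^sub>F x in cofin_nsets n D. l x \<notin> A B))"
proof -
  have avoid: "\<forall>\<^sub>F x in cofin_nsets n D. l x \<notin> Z" if "D \<subseteq> C" "finite Z" for D Z
    using that(2) filter_leD[OF cofin_nsets_mono[OF that(1)] l] by (intro eventually_notin_finite)
  obtain D1 where D1: "D1 \<subseteq> C" "infinite D1" "\<forall>i\<in>{..n}. \<exists>j\<le>n. has_level D1 n (\<lambda>x. l x ! i) j"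
    by (rule levels_exist[OF sb finite_atMost C])
  then obtain lev where lev: "\<forall>i\<in>{..n}. lev i \<le> n \<and> has_level D1 n (\<lambda>x. l x ! i) (lev i)" by metis
  show ?thesis
  proof (cases "\<exists>i\<le>n. lev i = 0")
    case True
    then obtain i where i: "i \<le> n" "lev i = 0" by blast
    with lev have i: "i \<le> n" "has_level D1 n (\<lambda>x. l x ! i) 0" by force+
    \<comment> \<open>A coordinate of level 0 is bounded, whereas each \<open>A B\<close> has only
      finitely many tuples with that coordinate bounded.\<close>
    obtain m where m: "\<forall>\<^sub>F x in cofin_nsets n D1. l x ! i \<le> m"
      using level_0_bounded[OF D1(2) i(2)] by blast
    have "\<forall>\<^sub>F x in cofin_nsets n D1. l x \<notin> A B" for B
      using m avoid[OF D1(1) sparse_lists_finite_le[OF sparse[of B] i(1), of m]]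
      by eventually_elim blast
    then show ?thesis using D1 by blast
  next
    case False
    then have "lev ` {..n} \<subseteq> {1..n}" using lev by (force simp: Suc_le_eq)
    \<comment> \<open>There are \<open>n + 1\<close> coordinates and only \<open>n\<close> positive
      levels.\<close>
    then have "\<not> inj_on lev {..n}"
      using card_mono[of "{1..n}" "lev ` {..n}"] by (intro pigeonhole) simp
    then obtain i i' where ii: "i < i'" "i' \<le> n" "lev i' = lev i"
      unfolding inj_on_def by (metis atMost_iff linorder_neqE_nat)
    have lv: "0 < lev i" "lev i \<le> n" "has_level D1 n (\<lambda>x. l x ! i) (lev i)" "has_level D1 n (\<lambda>x. l x ! i') (lev i)"
      using ii lev False by (metis atMost_iff gr0I le_trans less_imp_le)+
    obtain H where H: "\<forall>q. mono q \<longrightarrow> \<not> q \<le>\<^sup>* H \<longrightarrow>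
        (\<exists>D'\<subseteq>D1. infinite D' \<and> (\<forall>x\<in>[D']\<^bsup>n\<^esup>. l x ! i' < q (l x ! i)))"
      using same_level_dominated[OF D1(2) lv] by blast
    obtain k where k: "k \<in> Field r" "\<not> g k \<le>\<^sup>* H" using unbounded_g by blast
    then obtain D2 where D2: "D2 \<subseteq> D1" "infinite D2" "\<forall>x\<in>[D2]\<^bsup>n\<^esup>. l x ! i' < g k (l x ! i)"
      using H mono_g by blast
    define J where "J = insert k (underS r k)"
    have "small J"
      using small_Un[OF small_underS[OF k(1)] countable_small[of "{k}"]] by (simp add: J_def)
    then obtain D3 where D3: "D3 \<subseteq> D2" "infinite D3"
      "\<forall>j\<in>J. (\<forall>\<^sub>F x in cofin_nsets n D3. l x ! 0 \<in> S j) \<or> (\<forall>\<^sub>F x in cofin_nsets n D3. l x ! 0 \<notin> S j)"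
      using small_Ramsey[OF sb _ D2(2), where P = "\<lambda>j x. l x ! 0 \<in> S j"] by blast
    \<comment> \<open>The sides taken by the first coordinate of \<open>l x\<close>. Only those
      \<open>B\<close> whose node follows these sides, with index at most \<open>k\<close>, need a
      decision; an index together with \<open>t\<close> fixes the node, so there is at most one such
      \<open>B\<close> per index.\<close>
    define t where "t = {j. \<forall>\<^sub>F x in cofin_nsets n D3. l x ! 0 \<in> S j}"
    define \<B> where "\<B> = {B. split_index (E B) \<in> J \<and> snd (node (E B)) = t \<inter> underS r (split_index (E B))}"
    have "inj_on (\<lambda>B. split_index (E B)) \<B>"
    proof (rule inj_onI)
      fix B B' assume B: "B \<in> \<B>" "B' \<in> \<B>" and eq: "split_index (E B) = split_index (E B')"
      have "fst (node (E B)) = fst (node (E B'))" using eq by (simp add: node_def)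
      moreover have "snd (node (E B)) = snd (node (E B'))" using B eq by (simp add: \<B>_def)
      ultimately have "node (E B) = node (E B')" by (rule prod_eqI)
      then show "B = B'" using injD[OF inj_node] by blast
    qed
    moreover have "(\<lambda>B. split_index (E B)) ` \<B> \<subseteq> J" by (auto simp: \<B>_def)
    ultimately have "small \<B>" using small_inj[OF \<open>small J\<close>] by blast
    then obtain D4 where D4: "D4 \<subseteq> D3" "infinite D4"
      "\<forall>B\<in>\<B>. (\<forall>\<^sub>F x in cofin_nsets n D4. l x \<in> A B) \<or> (\<forall>\<^sub>F x in cofin_nsets n D4. l x \<notin> A B)"
      using small_Ramsey[OF sb _ D3(2), where P = "\<lambda>B x. l x \<in> A B"] by blast
    have sub: "D4 \<subseteq> C" using D1(1) D2(1) D3(1) D4(1) by blast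
    have "\<forall>\<^sub>F x in cofin_nsets n D4. l x \<notin> A B" if B: "B \<notin> \<B>" for B
    proof (cases "split_index (E B) \<in> J")
      case False
      \<comment> \<open>Beyond \<open>k\<close> the tuples of \<open>A B\<close> outgrow
        \<open>g k\<close>, while coordinate \<open>i'\<close> of \<open>l x\<close> stays below
        \<open>g k\<close> of coordinate \<open>i\<close>.\<close>
      then have "k \<in> underS r (split_index (E B))"
        using underS_total[OF k(1) split_index(1)[OF inf_E], of B] unfolding J_def by blast
      then have "finite {y \<in> A B. y ! i' \<le> g k (y ! i)}"
        by (rule sparse_lists_finite_dominated[OF sparse ii(1,2) dominated])
      from avoid[OF sub this] have "\<forall>\<^sub>F x in cofin_nsets n D4. l x \<notin> {y \<in> A B. y ! i' \<le> g k (y ! i)}" .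
      moreover have "\<forall>\<^sub>F x in cofin_nsets n D4. x \<in> [D2]\<^bsup>n\<^esup>"
        using D3(1) D4(1) by (intro filter_leD[OF cofin_nsets_mono eventually_cofin_nsets_in]) blast
      ultimately show ?thesis
        by eventually_elim (use D2(3) in \<open>auto simp: less_imp_le\<close>)
    next
      case True
      \<comment> \<open>At \<open>j\<close> the set \<open>E B\<close> lies almost on the side of
        \<open>S j\<close> that the first coordinate of \<open>l x\<close> eventually
        leaves.\<close>
      then obtain j where j: "j \<in> underS r (split_index (E B))" "finite (E B - S j) \<noteq> (j \<in> t)"
        using B unfolding \<B>_def node_def by auto
      have "trans r" "antisym r" using wo unfolding well_order_on_def linear_order_on_def partial_order_on_def preorder_on_def by blast+
      then have "j \<in> J"
        using j(1) True underS_incr[of r "split_index (E B)" k] unfolding J_def underS_def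
        by (auto dest: transD antisymD)
      have ns: "\<not> splits (S j) (E B)" using split_index(3)[OF inf_E j(1)] .
      show ?thesis
      proof (cases "j \<in> t")
        case True
        then have "finite (E B \<inter> S j)" using j(2) ns unfolding splits_def by blast
        then have "finite {y \<in> A B. y ! 0 \<in> S j}" by (rule sparse_lists_finite_in[OF sparse le0])
        note avoid[OF sub this]
        moreover have "\<forall>\<^sub>F x in cofin_nsets n D4. l x ! 0 \<in> S j"
          using True unfolding t_def by (intro filter_leD[OF cofin_nsets_mono[OF D4(1)]]) simp
        ultimately show ?thesis by eventually_elim blast
      next
        case False
        then have "finite (E B \<inter> - S j)" using j(2) by (simp add: Diff_eq)
        then have "finite {y \<in> A B. y ! 0 \<in> - S j}" by (rule sparse_lists_finite_in[OF sparse le0])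
        note avoid[OF sub this]
        moreover have "\<forall>\<^sub>F x in cofin_nsets n D4. l x ! 0 \<notin> S j"
          using False D3(3) \<open>j \<in> J\<close> unfolding t_def by (intro filter_leD[OF cofin_nsets_mono[OF D4(1)]]) blast
        ultimately show ?thesis by eventually_elim blast
      qed
    qed
    then have "(\<exists>B. \<forall>\<^sub>F x in cofin_nsets n D4. l x \<in> A B) \<or> (\<forall>B. \<forall>\<^sub>F x in cofin_nsets n D4. l x \<notin> A B)"
      using D4(3) by metis
    then show ?thesis using sub D4(2) by blast
  qed
qed

lemma n_sequentially_compact_franklin: "n_sequentially_compact n (franklin_space N (range A))"
  unfolding n_sequentially_compact_def nset_converges_iff_limitin
proof
  let ?X = "franklin_space N (range A)"
  fix f :: "nat set \<Rightarrow> (nat list + nat list set) option"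
  assume f: "f \<in> [UNIV :: nat set]\<^bsup>n\<^esup> \<rightarrow> topspace ?X"
  have nsets: "\<forall>\<^sub>F x in cofin_nsets n D. x \<in> [UNIV]\<^bsup>n\<^esup>" for D :: "nat set"
    using nsets_mono[OF subset_UNIV, of D n] by (intro eventually_mono[OF eventually_cofin_nsets_in]) (rule subsetD)
  have top: "\<forall>\<^sub>F x in cofin_nsets n D. f x \<in> topspace ?X" for D
    using nsets by (rule eventually_mono) (use f in blast)
  have "countable ([UNIV :: nat set]\<^bsup>n\<^esup>)"
    by (rule countable_subset[OF _ countable_Collect_finite]) (auto simp: nsets_def)
  \<comment> \<open>Only countably many values occur, so on a smaller domain \<open>f\<close> is
    either eventually constant or eventually leaves every value.\<close>
  then have "small (f ` [UNIV]\<^bsup>n\<^esup>)" by (intro countable_small countable_image)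
  then obtain D1 where D1: "infinite D1"
    "\<forall>v\<in>f ` [UNIV]\<^bsup>n\<^esup>. (\<forall>\<^sub>F x in cofin_nsets n D1. f x = v) \<or> (\<forall>\<^sub>F x in cofin_nsets n D1. f x \<noteq> v)"
    using small_Ramsey[OF sb _ infinite_UNIV_nat, where P = "\<lambda>v x. f x = v"] by blast
  show "\<exists>D. infinite D \<and> (\<exists>p. limitin ?X f p (cofin_nsets n D))"
  proof (cases "\<exists>v\<in>f ` [UNIV]\<^bsup>n\<^esup>. \<forall>\<^sub>F x in cofin_nsets n D1. f x = v")
    case True
    then obtain v where v: "v \<in> topspace ?X" "\<forall>\<^sub>F x in cofin_nsets n D1. f x = v" using f by blast
    have "limitin ?X f v (cofin_nsets n D1)"
      unfolding limitin_def using v(1) by (auto intro: eventually_mono[OF v(2)])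
    then show ?thesis using D1(1) by blast
  next
    case False
    have D1': "\<forall>\<^sub>F x in cofin_nsets n D1. f x \<noteq> v" for v
    proof (cases "v \<in> f ` [UNIV]\<^bsup>n\<^esup>")
      case True
      then show ?thesis using D1(2) False by blast
    next
      case nin: False
      show ?thesis using nsets by (rule eventually_mono) (use nin in blast)
    qed
    \<comment> \<open>A single colouring decides whether the values are isolated points.\<close>
    have "small {()}" by (intro countable_small) simp
    then obtain D2 where D2: "D2 \<subseteq> D1" "infinite D2"
      "(\<forall>\<^sub>F x in cofin_nsets n D2. f x \<in> range (Some \<circ> Inl)) \<or> (\<forall>\<^sub>F x in cofin_nsets n D2. f x \<notin> range (Some \<circ> Inl))"
      using small_Ramsey[OF sb _ D1(1), where P = "\<lambda>_ x. f x \<in> range (Some \<circ> Inl)"] by blast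
    have D2': "\<forall>\<^sub>F x in cofin_nsets n D. f x \<noteq> v" if "D \<subseteq> D2" for v D
      using that D2(1) by (intro filter_leD[OF cofin_nsets_mono D1']) blast
    from D2(3) show ?thesis
    proof
      \<comment> \<open>The values are then members of the family or infinity, and each is
        eventually left, so the limit is infinity.\<close>
      assume nin: "\<forall>\<^sub>F x in cofin_nsets n D2. f x \<notin> range (Some \<circ> Inl)"
      have "limitin ?X f None (cofin_nsets n D2)"
      proof (intro limitin_franklin_None[OF almost_disjoint] ballI top D2'[OF order_refl])
        fix X
        show "\<forall>\<^sub>F x in cofin_nsets n D2. f x \<noteq> Some (Inr X) \<and> f x \<notin> Some ` Inl ` X"
          using nin D2'[OF order_refl, of "Some (Inr X)"] by eventually_elim auto
      qed
      then show ?thesis using D2(2) by blast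
    next
      define l where "l x = projl (the (f x))" for x
      assume "\<forall>\<^sub>F x in cofin_nsets n D2. f x \<in> range (Some \<circ> Inl)"
      then have l: "\<forall>\<^sub>F x in cofin_nsets n D2. f x = Some (Inl (l x))"
        by (rule eventually_mono) (auto simp: l_def)
      have "\<forall>\<^sub>F x in cofin_nsets n D2. l x \<noteq> s" for s
        using l D2'[OF order_refl, of "Some (Inl s)"] by eventually_elim auto
      then obtain D where D: "D \<subseteq> D2" "infinite D"
        "(\<exists>B. \<forall>\<^sub>F x in cofin_nsets n D. l x \<in> A B) \<or> (\<forall>B. \<forall>\<^sub>F x in cofin_nsets n D. l x \<notin> A B)"
        using in_or_eventually_avoids[OF D2(2), of l] by blast
      have lD: "\<forall>\<^sub>F x in cofin_nsets n D. f x = Some (Inl (l x))"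
        by (rule filter_leD[OF cofin_nsets_mono[OF D(1)] l])
      from D(3) show ?thesis
      proof
        assume "\<exists>B. \<forall>\<^sub>F x in cofin_nsets n D. l x \<in> A B"
        then obtain B where B: "\<forall>\<^sub>F x in cofin_nsets n D. l x \<in> A B" by blast
        have "limitin ?X f (Some (Inr (A B))) (cofin_nsets n D)"
        proof (intro limitin_franklin_Inr[OF almost_disjoint] ballI D2'[OF D(1)])
          show "\<forall>\<^sub>F x in cofin_nsets n D. f x \<in> Some ` Inl ` A B"
            using lD B by eventually_elim simp
        qed simp
        then show ?thesis using D(2) by blast
      next
        assume nin: "\<forall>B. \<forall>\<^sub>F x in cofin_nsets n D. l x \<notin> A B"
        have "limitin ?X f None (cofin_nsets n D)"
        proof (intro limitin_franklin_None[OF almost_disjoint] ballI top D2'[OF D(1)])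
          fix X assume "X \<in> range A"
          then obtain B where "X = A B" by blast
          then have "\<forall>\<^sub>F x in cofin_nsets n D. l x \<notin> X" using nin by blast
          with lD show "\<forall>\<^sub>F x in cofin_nsets n D. f x \<noteq> Some (Inr X) \<and> f x \<notin> Some ` Inl ` X"
            by eventually_elim auto
        qed
        then show ?thesis using D(2) by blast
      qed
    qed
  qed
qed

section \<open>Failure in dimension \<open>n + 1\<close>\<close>

lemma sorted_list_of_set_A:
  assumes "y \<in> A B"
  shows "sorted_list_of_set (set y) = y" "card (set y) = Suc n"
proof -
  have len: "length y = Suc n" by (rule sparse_listsD(3)[OF sparse assms])
  have "sorted_wrt (<) y"
    unfolding sorted_wrt_iff_nth_less using sparse_listsD(7)[OF sparse assms] len by simp
  then have "sorted y" "distinct y" by (simp_all add: strict_sorted_iff)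
  then show "sorted_list_of_set (set y) = y" "card (set y) = Suc n"
    using len by (simp_all add: sorted_list_of_set.idem_if_sorted_distinct distinct_card)
qed

text \<open>The witness lists a set increasingly. Infinity is no limit on \<open>B\<close> since
  \<open>A B\<close> consists of tuples from \<open>B\<close>; a tuple is none since entries can be
  avoided; a member is none since its tuples have distinct first coordinates.\<close>

lemma not_Suc_n_sequentially_compact_franklin:
  "\<not> n_sequentially_compact (Suc n) (franklin_space N (range A))"
proof
  let ?X = "franklin_space N (range A)"
  let ?f = "\<lambda>x :: nat set. Some (Inl (sorted_list_of_set x)) :: (nat list + nat list set) option"
  assume "n_sequentially_compact (Suc n) ?X"
  moreover have "?f \<in> [UNIV]\<^bsup>Suc n\<^esup> \<rightarrow> topspace ?X"
    unfolding topspace_franklin_space[OF almost_disjoint] by (auto simp: nsets_def)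
  ultimately have "\<exists>B. infinite B \<and> (\<exists>p. limitin ?X ?f p (cofin_nsets (Suc n) B))"
    unfolding n_sequentially_compact_def nset_converges_iff_limitin by (rule bspec)
  then obtain B p where B: "infinite B" and p: "limitin ?X ?f p (cofin_nsets (Suc n) B)" by blast
  have "p \<in> topspace ?X" using p unfolding limitin_def by blast
  then consider "p = None" | s where "s \<in> N" "p = Some (Inl s)" | B' where "p = Some (Inr (A B'))"
    unfolding topspace_franklin_space[OF almost_disjoint] by blast
  then show False
  proof cases
    case 1
    have "openin ?X (franklin_nbhd N (range A) {A B} {})"
      by (rule openin_franklin_nbhd[OF almost_disjoint]) auto
    moreover have "p \<in> franklin_nbhd N (range A) {A B} {}" by (simp add: 1 franklin_nbhd_def)
    ultimately have "\<forall>\<^sub>F x in cofin_nsets (Suc n) B. ?f x \<in> franklin_nbhd N (range A) {A B} {}"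
      by (rule limitinD[OF p])
    then have "\<forall>\<^sub>F x in cofin_nsets (Suc n) B. sorted_list_of_set x \<notin> A B"
      by (rule eventually_mono) (auto simp: franklin_nbhd_def)
    then obtain F where F: "finite F" "\<forall>x\<in>[B - F]\<^bsup>Suc n\<^esup>. sorted_list_of_set x \<notin> A B"
      unfolding eventually_cofin_nsets by blast
    obtain m where m: "\<forall>k\<in>F. k \<le> m" using F(1) unfolding finite_nat_set_iff_bounded_le by blast
    have "A B - {y \<in> A B. y ! 0 \<le> m} \<noteq> {}"
      using Diff_infinite_finite[OF sparse_lists_finite_le[OF sparse[of B] le0, of m] sparse_listsD(1)[OF sparse[of B]]]
      by (intro infinite_imp_nonempty)
    \<comment> \<open>Tuples increase, so once the first entry exceeds \<open>m\<close> all entries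
      avoid \<open>F\<close>; they lie in \<open>B\<close> because \<open>E B\<close> does.\<close>
    then obtain y where "y \<in> A B - {y \<in> A B. y ! 0 \<le> m}" by blast
    then have y: "y \<in> A B" "m < y ! 0" by (simp_all add: not_le)
    have "c \<in> B - F" if c: "c \<in> set y" for c
    proof -
      obtain i where i: "i \<le> n" "c = y ! i"
        using c sparse_listsD(3)[OF sparse y(1)] by (auto simp: in_set_conv_nth less_Suc_eq_le)
      have "c \<in> B" using sparse_listsD(4)[OF sparse y(1) i(1)] E_subset[OF B] i(2) by blast
      moreover have "y ! 0 \<le> c" using sparse_listsD(7)[OF sparse y(1), of 0 i] i by (cases "i = 0") auto
      ultimately show ?thesis using m y(2) by fastforce
    qed
    then have "set y \<in> [B - F]\<^bsup>Suc n\<^esup>" using sorted_list_of_set_A(2)[OF y(1)] by (auto simp: nsets_def)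
    then show False using F(2) sorted_list_of_set_A(1)[OF y(1)] y(1) by metis
  next
    case (2 s)
    have "openin ?X (Some ` {Inl s})"
      by (rule openin_franklin_space_Some) (use 2(1) in \<open>auto simp: openin_isbell_mrowka_space\<close>)
    from limitinD[OF p this] have "\<forall>\<^sub>F x in cofin_nsets (Suc n) B. sorted_list_of_set x = s"
      by (simp add: 2(2))
    then obtain F where F: "finite F" "\<forall>x\<in>[B - F]\<^bsup>Suc n\<^esup>. sorted_list_of_set x = s"
      unfolding eventually_cofin_nsets by blast
    obtain x where x: "x \<in> [B - (F \<union> set s)]\<^bsup>Suc n\<^esup>"
      using B F(1) nsets_eq_empty_iff[of "B - (F \<union> set s)" "Suc n"] by (metis Diff_infinite_finite List.finite_set ex_in_conv finite_UnI)
    then have x: "finite x" "x \<noteq> {}" "x \<inter> set s = {}" "x \<in> [B - F]\<^bsup>Suc n\<^esup>" by (auto simp: nsets_def)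
    have "set s = x" using bspec[OF F(2) x(4)] set_sorted_list_of_set[OF x(1)] by simp
    then show False using x(2,3) by simp
  next
    case (3 B')
    let ?V = "insert (Inr (A B')) (Inl ` A B')"
    have "openin (isbell_mrowka_space N (range A)) ?V"
      unfolding openin_isbell_mrowka_space
    proof (intro conjI ballI impI)
      show "?V \<subseteq> N <+> range A" using sparse_listsD(3)[OF sparse[of B']] by auto
      fix X assume "Inr X \<in> ?V"
      then have "X = A B'" by blast
      then show "\<exists>F. finite F \<and> F \<subseteq> N \<and> Inl ` (X - F) \<subseteq> ?V" by (intro exI[of _ "{}"]) auto
    qed
    from limitinD[OF p openin_franklin_space_Some[OF this]]
    have "\<forall>\<^sub>F x in cofin_nsets (Suc n) B. ?f x \<in> Some ` ?V" by (simp add: 3)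
    then have "\<forall>\<^sub>F x in cofin_nsets (Suc n) B. sorted_list_of_set x \<in> A B'"
      by (rule eventually_mono) auto
    then obtain F where F: "finite F" "\<forall>x\<in>[B - F]\<^bsup>Suc n\<^esup>. sorted_list_of_set x \<in> A B'"
      unfolding eventually_cofin_nsets by blast
    have inf: "infinite (B - F)" using B F(1) by simp
    then obtain a where a: "a \<in> B - F" using infinite_imp_nonempty by blast
    have D: "infinite (B - F - {..a})" using inf by simp
    have in_A: "a # sorted_list_of_set z \<in> A B'" if z: "z \<in> [B - F - {..a}]\<^bsup>n\<^esup>" for z
    proof -
      have fz: "finite z" "z \<subseteq> B - F - {..a}" "card z = n" using z by (auto simp: nsets_def)
      have "insert a z \<in> [B - F]\<^bsup>Suc n\<^esup>" using fz a by (auto simp: nsets_def card_insert_if)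
      moreover have "sorted (a # sorted_list_of_set z)" "distinct (a # sorted_list_of_set z)"
        using fz by (auto simp: less_imp_le)
      then have "sorted_list_of_set (set (a # sorted_list_of_set z)) = a # sorted_list_of_set z"
        by (rule sorted_list_of_set.idem_if_sorted_distinct)
      then have "sorted_list_of_set (insert a z) = a # sorted_list_of_set z" using fz(1) by simp
      ultimately show ?thesis using F(2) by metis
    qed
    obtain z where z: "z \<in> [B - F - {..a}]\<^bsup>n\<^esup>"
      using D nsets_eq_empty_iff[of "B - F - {..a}" n] by blast
    then have fz: "finite z" "card z = n" by (auto simp: nsets_def)
    \<comment> \<open>Two disjoint continuations of the same first entry \<open>a\<close> give
      tuples in \<open>A B'\<close>, which must coincide; they are nonempty since
      \<open>n \<ge> 1\<close>.\<close>
    obtain z' where z': "z' \<in> [B - F - {..a} - z]\<^bsup>n\<^esup>"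
      using D fz(1) nsets_eq_empty_iff[of "B - F - {..a} - z" n] by (metis Diff_infinite_finite ex_in_conv)
    then have fz': "finite z'" "z' \<inter> z = {}" "z' \<in> [B - F - {..a}]\<^bsup>n\<^esup>" by (auto simp: nsets_def)
    have "a # sorted_list_of_set z = a # sorted_list_of_set z'"
      by (rule inj_onD[OF sparse_listsD(2)[OF sparse[of B']] _ in_A[OF z] in_A[OF fz'(3)]]) simp
    then have "z = z'" using fz(1) fz'(1) by (metis list.inject set_sorted_list_of_set)
    then have "z = {}" using fz'(2) by blast
    then show False using fz(2) n by simp
  qed
qed

end

text \<open>Running maxima are pointwise at least the original functions, so they stay unbounded and
  become monotone.\<close>

lemma monotone_unbounded:
  assumes "unbounded_family \<B>"
  shows "\<exists>b\<in>\<B>. \<not> (\<lambda>m. Max (b ` {..m})) \<le>\<^sup>* f"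
proof -
  obtain b where b: "b \<in> \<B>" "infinite {m. f m < b m}"
    using assms unfolding unbounded_family_def eventually_le_def by blast
  have "b m \<le> Max (b ` {..m})" for m by (intro Max_ge) auto
  then have "{m. f m < b m} \<subseteq> {m. f m < Max (b ` {..m})}" using less_le_trans by blast
  then have "infinite {m. f m < Max (b ` {..m})}" using b(2) finite_subset by blast
  then show ?thesis using b(1) unfolding eventually_le_def by blast
qed

theorem theorem52:
  fixes n :: nat
  assumes "splitting_number =o bounding_number"
    and "n \<ge> 1"
  shows "\<exists>\<A> :: nat list set set.
    almost_disjoint_family {xs. length xs = n + 1} \<A> \<and>
    |\<A>| =o |UNIV :: real set| \<and>
    n_sequentially_compact n (franklin_space {xs. length xs = n + 1} \<A>) \<and>
    \<not> n_sequentially_compact (n + 1) (franklin_space {xs. length xs = n + 1} \<A>)"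
proof -
  obtain \<B> where \<B>: "unbounded_family \<B>" "bounding_number = |\<B>|"
    by (rule bounding_number_attained)
  obtain \<S> where \<S>: "splitting_family \<S>" "splitting_number = |\<S>|"
    by (rule min_card_attained[where P = splitting_family, OF splitting_family_infinite_sets])
      (simp add: splitting_number_def)
  have "|\<B>| =o |\<S>|" using ordIso_symmetric[OF assms(1)] unfolding \<B>(2) \<S>(2) .
  then obtain S where "bij_betw S \<B> \<S>" using card_of_ordIso by blast
  then have S: "S ` \<B> = \<S>" by (rule bij_betw_imp_surj_on)
  \<comment> \<open>The unbounded family serves as its own index set; its cardinal order has small
    proper initial segments.\<close>
  interpret splitting_bounding "|\<B>|" "\<lambda>b m. Max (b ` {..m})" S
  proof
    show "splitting_number =o bounding_number" by (rule assms(1))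
    show "Well_order |\<B>|" by (rule card_of_Well_order)
    show "small (underS |\<B>| b)" if "b \<in> Field |\<B>|" for b
      unfolding small_def \<B>(2) by (rule card_of_underS[OF card_of_Card_order that])
    show "mono (\<lambda>m. Max (b ` {..m}))" for b :: "nat \<Rightarrow> nat"
      by (rule monoI, rule Max_mono) auto
    show "\<exists>b\<in>Field |\<B>|. \<not> (\<lambda>m. Max (b ` {..m})) \<le>\<^sup>* f" for f
      unfolding Field_card_of by (rule monotone_unbounded[OF \<B>(1)])
    show "\<exists>b\<in>Field |\<B>|. splits (S b) E" if "infinite E" for E
      using \<S>(1) that S unfolding splitting_family_def splits_def Field_card_of by blast
  qed
  obtain E A G where fam: "\<forall>B. infinite (E B)" "\<forall>B. infinite B \<longrightarrow> E B \<subseteq> B" "inj (\<lambda>B. node (E B))"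
    "\<forall>B. sparse_lists n (E B) (S (split_index (E B))) (G B) (A B)"
    "\<forall>B. \<forall>k\<in>underS |\<B>| (split_index (E B)). (\<lambda>m. Max (k ` {..m})) \<le>\<^sup>* G B"
    using family_exists[OF assms(2)] by blast
  interpret sparse_list_family "|\<B>|" "\<lambda>b m. Max (b ` {..m})" S n E A G
    by unfold_locales (use assms(2) fam in blast)+
  show ?thesis
    using almost_disjoint card_range_A n_sequentially_compact_franklin
      not_Suc_n_sequentially_compact_franklin[unfolded Suc_eq_plus1] by (intro exI conjI)
qed

end
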